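(* For each $p$ let $X\in\mathbb{R}^{n\times p}$ ($n=n(p)$) have unit normed columns in general position, and let $R=X^TX$. Assume there is some $\delta>0$ (not depending on $p$) such that for each $j=1,\ldots,p$ there exists a subset of indices $S\subseteq\{1,\ldots,p\}\setminus\{j\}$ with $$1-R_{i,S\setminus\{i\}}(R_{S\setminus\{i\},S\setminus\{i\}})^{-1}R_{S\setminus\{i\},i}\ \ge\ \delta^2\quad\text{for all }i\in S,$$ and with the size of $S$ growing faster than $\log p$: $$|S|\ge d_p,\quad\text{where } \frac{d_p}{\log p}\to\infty\text{ as }p\to\infty .$$ Then under the null distribution $y\sim N(0,\sigma^2I)$ (with $\sigma^2>0$ fixed), the covariance test statistic $T_1$ at the first step of the lasso path satisfies $\mathbb{P}(T_1>t)\to e^{-t}$ as $p\to\infty$, for all $t\ge0$.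
   Context: $R_{S,S'}$ denotes the submatrix of $R$ with rows in $S$ and columns in $S'$ (the inverse above presupposes invertibility). $X_j$ is the $j$th column of $X$. General position: the columns $X_1,\ldots,X_p\in\mathbb{R}^n$ are in general position if no $k$-dimensional affine subspace of $\mathbb{R}^n$, $k<\min\{n,p\}$, contains more than $k+1$ elements of $\{\pm X_1,\ldots,\pm X_p\}$, excluding antipodal pairs. Lasso path: for $\lambda>0$ let $\hat\beta(\lambda)=\operatorname{argmin}_{\beta\in\mathbb{R}^p}\frac12\|y-X\beta\|_2^2+\lambda\|\beta\|_1$ (unique under general position). The map $\lambda\mapsto\hat\beta(\lambda)$ is continuous and piecewise linear, zero for large $\lambda$; its knots $\lambda_1\ge\lambda_2\ge\cdots\ge0$ are the values at which, as $\lambda$ decreases from $\infty$, a variable enters or leaves the active set $\operatorname{supp}(\hat\beta(\lambda))$. The covariance test statistic at the first step (the active set before $\lambda_1$ being empty) is $T_1=\langle y,X\hat\beta(\lambda_2)\rangle/\sigma^2$. *)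

theory Defs
  imports
    "HOL-Probability.Probability"
    "Jordan_Normal_Form.VS_Connect"
    "Jordan_Normal_Form.DL_Submatrix"
    "Jordan_Normal_Form.Gauss_Jordan_Elimination"
begin

hide_type (open) Finite_Cartesian_Product.vec
hide_const (open) Finite_Cartesian_Product.vec
unbundle no vec_syntax and no inner_syntax

text \<open>Columns and coordinates are indexed from 0, so the index set \<open>{1, \<dots>, p}\<close> is \<open>{..<p}\<close>.\<close>

definition l1_norm :: "real vec \<Rightarrow> real" where
  "l1_norm v = (\<Sum>i<dim_vec v. \<bar>v $ i\<bar>)"

definition l2_norm :: "real vec \<Rightarrow> real" where
  "l2_norm v = sqrt (v \<bullet> v)"

definition affine_subspace :: "nat \<Rightarrow> nat \<Rightarrow> real vec set \<Rightarrow> bool" where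
  "affine_subspace n k L \<longleftrightarrow>
     (\<exists>a \<in> carrier_vec n. \<exists>W. subspace class_ring W (module_vec TYPE(real) n) \<and>
        vectorspace.dim class_ring ((module_vec TYPE(real) n)\<lparr>carrier := W\<rparr>) = k \<and>
        L = (\<lambda>w. a + w) ` W)"

text \<open>
  Elements of \<open>{\<plusminus>X\<^sub>1, \<dots>, \<plusminus>X\<^sub>p}\<close> are counted by their column index, so that coinciding columns
  count separately; antipodal pairs are excluded by choosing one sign per index.
\<close>
definition columns_in_general_position :: "real mat \<Rightarrow> bool" where
  "columns_in_general_position X \<longleftrightarrow>
     (\<forall>k < min (dim_row X) (dim_col X). \<forall>L. affine_subspace (dim_row X) k L \<longrightarrow>
        (\<forall>J \<subseteq> {..<dim_col X}. \<forall>s :: nat \<Rightarrow> real.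
           (\<forall>j\<in>J. s j \<in> {1, -1}) \<and> (\<forall>j\<in>J. s j \<cdot>\<^sub>v col X j \<in> L) \<longrightarrow> card J \<le> k + 1))"

text \<open>
  The quantity \<open>1 - R\<^bsub>i,S\<setminus>i\<^esub> (R\<^bsub>S\<setminus>i,S\<setminus>i\<^esub>)\<^sup>-\<^sup>1 R\<^bsub>S\<setminus>i,i\<^esub>\<close>. It is meaningful only if
  \<open>R\<^bsub>S\<setminus>i,S\<setminus>i\<^esub>\<close> is invertible, which has to be required separately.
\<close>
definition partial_variance :: "real mat \<Rightarrow> nat set \<Rightarrow> nat \<Rightarrow> real" where
  "partial_variance R S i =
     1 - (submatrix R {i} (S - {i})
          * the (mat_inverse (submatrix R (S - {i}) (S - {i})))
          * submatrix R (S - {i}) {i}) $$ (0, 0)"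

definition lasso_objective :: "real mat \<Rightarrow> real vec \<Rightarrow> real \<Rightarrow> real vec \<Rightarrow> real" where
  "lasso_objective X y l \<beta> = 1/2 * (l2_norm (y - X *\<^sub>v \<beta>))\<^sup>2 + l * l1_norm \<beta>"

definition lasso :: "real mat \<Rightarrow> real vec \<Rightarrow> real \<Rightarrow> real vec" where
  "lasso X y l = arg_min (lasso_objective X y l) (\<lambda>\<beta>. \<beta> \<in> carrier_vec (dim_col X))"

definition active_set :: "real mat \<Rightarrow> real vec \<Rightarrow> real \<Rightarrow> nat set" where
  "active_set X y l = {j. j < dim_col X \<and> lasso X y l $ j \<noteq> 0}"

text \<open>Entering and leaving refer to \<open>\<lambda>\<close> decreasing through \<open>m\<close>.\<close>

definition enters_at :: "real mat \<Rightarrow> real vec \<Rightarrow> real \<Rightarrow> nat \<Rightarrow> bool" where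
  "enters_at X y m j \<longleftrightarrow>
     (\<forall>\<^sub>F l in at_right m. j \<notin> active_set X y l) \<and> (\<forall>\<^sub>F l in at_left m. j \<in> active_set X y l)"

definition leaves_at :: "real mat \<Rightarrow> real vec \<Rightarrow> real \<Rightarrow> nat \<Rightarrow> bool" where
  "leaves_at X y m j \<longleftrightarrow>
     (\<forall>\<^sub>F l in at_right m. j \<in> active_set X y l) \<and> (\<forall>\<^sub>F l in at_left m. j \<notin> active_set X y l)"

definition path_events :: "real mat \<Rightarrow> real vec \<Rightarrow> (real \<times> nat) set" where
  "path_events X y = {(m, j). 0 < m \<and> j < dim_col X \<and> (enters_at X y m j \<or> leaves_at X y m j)}"

text \<open>
  The knots \<open>\<lambda>\<^sub>1 \<ge> \<lambda>\<^sub>2 \<ge> \<dots> \<ge> 0\<close> are the event values listed in decreasing order with multiplicity: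
  \<open>\<lambda>\<^sub>k\<close> is the largest \<open>l\<close> such that at least \<open>k\<close> events occur at values \<open>\<ge> l\<close>, and it is 0 if
  the path has fewer than \<open>k\<close> events (under general position there are only finitely many).
\<close>
definition lasso_knot :: "real mat \<Rightarrow> real vec \<Rightarrow> nat \<Rightarrow> real" where
  "lasso_knot X y k =
     Sup (insert 0 {l. 0 < l \<and> k \<le> card {(m, j). (m, j) \<in> path_events X y \<and> l \<le> m}})"

text \<open>
  If \<open>\<lambda>\<^sub>2 = 0\<close> the minimiser need not be unique, but the fit \<open>X *\<^sub>v lasso X y 0\<close>, a projection
  of \<open>y\<close>, is.
\<close>
definition cov_test_stat1 :: "real mat \<Rightarrow> real vec \<Rightarrow> real \<Rightarrow> real" where
  "cov_test_stat1 X y \<sigma> = (y \<bullet> (X *\<^sub>v lasso X y (lasso_knot X y 2))) / \<sigma>\<^sup>2"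

definition isotropic_gaussian :: "'a measure \<Rightarrow> nat \<Rightarrow> real \<Rightarrow> ('a \<Rightarrow> real vec) \<Rightarrow> bool" where
  "isotropic_gaussian M n \<sigma> y \<longleftrightarrow>
     prob_space M \<and> (\<forall>\<omega> \<in> space M. y \<omega> \<in> carrier_vec n) \<and>
     prob_space.indep_vars M (\<lambda>_. borel) (\<lambda>i \<omega>. y \<omega> $ i) {..<n} \<and>
     (\<forall>i<n. distributed M lborel (\<lambda>\<omega>. y \<omega> $ i) (normal_density 0 \<sigma>))"

end

theory Submission
  imports Defs "HOL-Real_Asymp.Real_Asymp"
begin

text \<open>
  Write \<open>U\<^sub>k = \<langle>X\<^sub>k, y\<rangle>\<close>. If \<open>s U\<^sub>j\<close> (with \<open>s = \<plusminus>1\<close>) is the largest of all \<open>\<plusminus>U\<^sub>k\<close>, the first knot is \<open>s U\<^sub>j\<close>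
  and the second one is the maximum \<open>V\<close> over \<open>k \<noteq> j\<close> and \<open>s' = \<plusminus>1\<close> of the values
  \<open>s' (U\<^sub>k - R\<^sub>k\<^sub>j U\<^sub>j) / (1 - s s' R\<^sub>k\<^sub>j)\<close>, so that \<open>\<sigma>\<^sup>2 T\<^sub>1 = s U\<^sub>j (s U\<^sub>j - V)\<close>. Moreover \<open>s U\<^sub>j\<close> is the
  largest exactly when \<open>s U\<^sub>j > V\<close>, and \<open>V\<close> depends only on the projection of \<open>y\<close> orthogonal to \<open>X\<^sub>j\<close>,
  hence is independent of \<open>U\<^sub>j\<close>. Conditionally on \<open>V = m\<close> the statement reduces to
  \<open>\<P>(Z (Z - m) > t \<sigma>\<^sup>2, Z > m) \<approx> e\<^sup>-\<^sup>t \<P>(Z > m)\<close> for a centred Gaussian \<open>Z\<close>, with relative error tending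
  to 0 as \<open>m \<rightarrow> \<infinity>\<close>; summing over the \<open>2p\<close> pairs \<open>(j, s)\<close> leaves the error \<open>2p max \<P>(V \<le> m)\<close>.
  The event \<open>V \<le> m\<close> forces all \<open>|U\<^sub>k - R\<^sub>k\<^sub>j U\<^sub>j|\<close>, \<open>k \<in> S\<close>, to be bounded, which by the lower bound on
  the partial variances has probability at most \<open>C c\<^bsup>|S|\<^esup>\<close> with \<open>c < 1\<close>; this beats \<open>p\<close> because
  \<open>|S|\<close> grows faster than \<open>log p\<close>. Ties have probability 0 since three distinct unit vectors are never
  collinear.
\<close>

section \<open>Isotropic Gaussian measures\<close>

abbreviation normal_measure :: "real \<Rightarrow> real measure" where
  "normal_measure \<sigma> \<equiv> density lborel (\<lambda>x. ennreal (normal_density 0 \<sigma> x))"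

abbreviation normal_product :: "nat \<Rightarrow> real \<Rightarrow> (nat \<Rightarrow> real) measure" where
  "normal_product n \<sigma> \<equiv> PiM {..<n} (\<lambda>_. normal_measure \<sigma>)"

text \<open>Vectors are functions on indices because the product measure lives on functions; only
  the values at indices below \<open>n\<close> enter.\<close>

definition dot :: "nat \<Rightarrow> (nat \<Rightarrow> real) \<Rightarrow> (nat \<Rightarrow> real) \<Rightarrow> real" where
  "dot n a b = (\<Sum>i<n. a i * b i)"

lemma normal_density_rotate:
  assumes "c\<^sup>2 + s\<^sup>2 = 1"
  shows "normal_density 0 \<sigma> (c * a + s * b) * normal_density 0 \<sigma> (c * b - s * a) =
    normal_density 0 \<sigma> a * normal_density 0 \<sigma> b"
proof -
  have "(c * a + s * b)\<^sup>2 + (c * b - s * a)\<^sup>2 = (c\<^sup>2 + s\<^sup>2) * (a\<^sup>2 + b\<^sup>2)"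
    by (simp add: power2_eq_square algebra_simps)
  then have "(c * a + s * b)\<^sup>2 + (c * b - s * a)\<^sup>2 = a\<^sup>2 + b\<^sup>2" using assms by simp
  then have "- (c * a + s * b)\<^sup>2 / (2 * \<sigma>\<^sup>2) + - (c * b - s * a)\<^sup>2 / (2 * \<sigma>\<^sup>2)
      = - a\<^sup>2 / (2 * \<sigma>\<^sup>2) + - b\<^sup>2 / (2 * \<sigma>\<^sup>2)"
    by (metis (no_types, lifting) add_divide_distrib minus_add_distrib)
  then show ?thesis
    by (simp add: normal_density_def exp_add[symmetric])
qed

text \<open>The rotation is split into two shears with a Fubini swap in between. For fixed
  \<open>z\<close>, \<open>h\<close> is replaced by \<open>b = s * z + c * h\<close>; then, for
  fixed \<open>b\<close>, \<open>z\<close> is replaced by \<open>a = (z - s * b) / c\<close>. Both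
  are one-dimensional affine substitutions that are legitimate as \<open>c > 0\<close>, and their
  Jacobians \<open>1/c\<close> and \<open>c\<close> cancel. What remains is the rotation invariance
  of the product density.\<close>

lemma nn_integral_normal_rotate:
  fixes Q :: "real \<Rightarrow> real \<Rightarrow> ennreal"
  assumes Q: "case_prod Q \<in> borel_measurable (borel \<Otimes>\<^sub>M borel)"
    and cs: "c\<^sup>2 + s\<^sup>2 = 1" "c > 0"
  shows "(\<integral>\<^sup>+a. \<integral>\<^sup>+b. Q a b \<partial>normal_measure \<sigma> \<partial>normal_measure \<sigma>) =
    (\<integral>\<^sup>+z. \<integral>\<^sup>+h. Q (c * z - s * h) (s * z + c * h) \<partial>normal_measure \<sigma> \<partial>normal_measure \<sigma>)"
proof -
  let ?f = "\<lambda>x. ennreal (normal_density 0 \<sigma> x)"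
  note [measurable] = Q
  have c2: "1 - s * s = c * c" "s * s = 1 - c * c" using cs by (auto simp: power2_eq_square)
  have "(\<integral>\<^sup>+z. \<integral>\<^sup>+h. Q (c * z - s * h) (s * z + c * h) \<partial>normal_measure \<sigma> \<partial>normal_measure \<sigma>) =
    (\<integral>\<^sup>+z. \<integral>\<^sup>+h. ?f z * (?f h * Q (c * z - s * h) (s * z + c * h)) \<partial>lborel \<partial>lborel)"
    by (simp add: nn_integral_density nn_integral_cmult)
  also have "\<dots> = (\<integral>\<^sup>+z. \<integral>\<^sup>+b. ennreal (1/c) * (?f z * (?f ((b - s * z)/c) * Q ((z - s * b)/c) b)) \<partial>lborel \<partial>lborel)"
  proof (rule nn_integral_cong)
    fix z
    have *: "c * z - s * (- (s * z)/c + 1/c * b) = (z - s * b)/c" "- (s * z)/c + 1/c * b = (b - s * z)/c"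
      "s * z + c * (- (s * z)/c + 1/c * b) = b" for b
    proof -
      have "c * (c * z) + s * (s * z) = z"
        using cs(1) by (simp add: power2_eq_square flip: distrib_right mult.assoc)
      then show "c * z - s * (- (s * z)/c + 1/c * b) = (z - s * b)/c"
        using cs(2) by (simp add: field_simps)
    qed (use cs in \<open>auto simp: field_simps\<close>)
    have "(\<integral>\<^sup>+h. ?f z * (?f h * Q (c * z - s * h) (s * z + c * h)) \<partial>lborel) =
      \<bar>1/c\<bar> * (\<integral>\<^sup>+b. ?f z * (?f (- (s * z)/c + 1/c * b) *
          Q (c * z - s * (- (s * z)/c + 1/c * b)) (s * z + c * (- (s * z)/c + 1/c * b))) \<partial>lborel)"
      by (rule nn_integral_real_affine) (use cs in \<open>auto\<close>)
    also have "\<dots> = (\<integral>\<^sup>+b. ennreal (1/c) * (?f z * (?f ((b - s * z)/c) * Q ((z - s * b)/c) b)) \<partial>lborel)"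
      unfolding *(1) unfolding *(2,3) using cs by (simp add: nn_integral_cmult)
    finally show "(\<integral>\<^sup>+h. ?f z * (?f h * Q (c * z - s * h) (s * z + c * h)) \<partial>lborel) =
       (\<integral>\<^sup>+b. ennreal (1/c) * (?f z * (?f ((b - s * z)/c) * Q ((z - s * b)/c) b)) \<partial>lborel)" .
  qed
  also have "\<dots> = (\<integral>\<^sup>+b. \<integral>\<^sup>+z. ennreal (1/c) * (?f z * (?f ((b - s * z)/c) * Q ((z - s * b)/c) b)) \<partial>lborel \<partial>lborel)"
    by (rule lborel_pair.Fubini') measurable
  also have "\<dots> = (\<integral>\<^sup>+b. \<integral>\<^sup>+a. ?f a * (?f b * Q a b) \<partial>lborel \<partial>lborel)"
  proof (rule nn_integral_cong)
    fix b
    have *: "(b - s * (s * b + c * a))/c = c * b - s * a" "(s * b + c * a - s * b)/c = a" for a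
    proof -
      have "b - s * (s * b + c * a) = (1 - s * s) * b - s * c * a" by (simp add: algebra_simps)
      also have "\<dots> = c * (c * b - s * a)" unfolding c2 by (simp add: algebra_simps)
      finally show "(b - s * (s * b + c * a))/c = c * b - s * a" using cs by simp
    qed (use cs in auto)
    have "(\<integral>\<^sup>+z. ennreal (1/c) * (?f z * (?f ((b - s * z)/c) * Q ((z - s * b)/c) b)) \<partial>lborel) =
      \<bar>c\<bar> * (\<integral>\<^sup>+a. ennreal (1/c) * (?f (s * b + c * a) * (?f ((b - s * (s * b + c * a))/c) * Q ((s * b + c * a - s * b)/c) b)) \<partial>lborel)"
      by (rule nn_integral_real_affine) (use cs in \<open>auto\<close>)
    also have "\<dots> = (\<integral>\<^sup>+a. ennreal c * (ennreal (1/c) * (?f (s * b + c * a) * (?f (c * b - s * a) * Q a b))) \<partial>lborel)"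
      unfolding * using cs by (simp add: nn_integral_cmult)
    also have "\<dots> = (\<integral>\<^sup>+a. ?f a * (?f b * Q a b) \<partial>lborel)"
    proof (rule nn_integral_cong)
      fix a
      have "ennreal c * ennreal (1/c) = 1" using cs by (simp flip: ennreal_mult)
      moreover have "?f (s * b + c * a) * ?f (c * b - s * a) = ?f a * ?f b"
        using normal_density_rotate[OF cs(1), of \<sigma> a b] by (simp flip: ennreal_mult add: add.commute)
      ultimately show "ennreal c * (ennreal (1/c) * (?f (s * b + c * a) * (?f (c * b - s * a) * Q a b))) = ?f a * (?f b * Q a b)"
        by (metis mult.assoc mult_1)
    qed
    finally show "(\<integral>\<^sup>+z. ennreal (1/c) * (?f z * (?f ((b - s * z)/c) * Q ((z - s * b)/c) b)) \<partial>lborel) =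
       (\<integral>\<^sup>+a. ?f a * (?f b * Q a b) \<partial>lborel)" .
  qed
  also have "\<dots> = (\<integral>\<^sup>+a. \<integral>\<^sup>+b. ?f a * (?f b * Q a b) \<partial>lborel \<partial>lborel)"
    by (rule lborel_pair.Fubini') measurable
  also have "\<dots> = (\<integral>\<^sup>+a. \<integral>\<^sup>+b. Q a b \<partial>normal_measure \<sigma> \<partial>normal_measure \<sigma>)"
    by (simp add: nn_integral_density nn_integral_cmult)
  finally show ?thesis by simp
qed

lemma prob_space_normal_measure: "0 < \<sigma> \<Longrightarrow> prob_space (normal_measure \<sigma>)"
  by (rule prob_space_normal_density)

lemma nn_integral_normal_measure_uminus:
  assumes [measurable]: "f \<in> borel_measurable borel"
  shows "(\<integral>\<^sup>+x. f (- x) \<partial>normal_measure \<sigma>) = (\<integral>\<^sup>+x. f x \<partial>normal_measure \<sigma>)"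
  by (simp add: nn_integral_density)
     (subst (2) nn_integral_real_affine[where c="-1" and t=0], auto simp: normal_density_def)

lemma sets_normal_product [measurable_cong]:
  "sets (normal_product n \<sigma>) = sets (PiM {..<n} (\<lambda>_. borel))"
  by (intro sets_PiM_cong) auto

lemma borel_measurable_dot [measurable]: "dot n a \<in> borel_measurable (PiM {..<n} (\<lambda>_. borel))"
  unfolding dot_def by measurable

lemma nn_integral_normal_product_Suc:
  assumes "0 < \<sigma>" and [measurable]: "F \<in> borel_measurable (PiM {..<Suc n} (\<lambda>_. borel))"
  shows "(\<integral>\<^sup>+y. F y \<partial>normal_product (Suc n) \<sigma>) =
    (\<integral>\<^sup>+y. \<integral>\<^sup>+x. F (y(n := x)) \<partial>normal_measure \<sigma> \<partial>normal_product n \<sigma>)"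
proof -
  interpret prob_space "normal_measure \<sigma>" using assms by (intro prob_space_normal_measure)
  interpret product_sigma_finite "\<lambda>_. normal_measure \<sigma>" by unfold_locales
  show ?thesis unfolding lessThan_Suc
    by (rule product_nn_integral_insert) (auto simp flip: lessThan_Suc)
qed

lemma dot_line:
  "dot n a (\<lambda>i\<in>{..<n}. y i + t * e i) = dot n a y + t * dot n a e"
  unfolding dot_def by (simp add: algebra_simps sum.distrib sum_distrib_left)

text \<open>
  Replacing the component of \<open>y\<close> along a unit vector \<open>e\<close> by an independent Gaussian does not change the
  law of \<open>y\<close>. This encodes the independence of \<open>\<langle>e, y\<rangle>\<close> and \<open>y - \<langle>e, y\<rangle> e\<close>. The induction step splits
  \<open>e = (c e', s)\<close> and rotates the plane spanned by \<open>e'\<close> and the last coordinate.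
\<close>
lemma nn_integral_normal_product_resample:
  assumes "0 < \<sigma>" "dot n e e = 1" "F \<in> borel_measurable (PiM {..<n} (\<lambda>_. borel))"
  shows "(\<integral>\<^sup>+y. F y \<partial>normal_product n \<sigma>) =
    (\<integral>\<^sup>+y. \<integral>\<^sup>+z. F (\<lambda>i\<in>{..<n}. y i + (z - dot n e y) * e i) \<partial>normal_measure \<sigma> \<partial>normal_product n \<sigma>)"
  using assms(2,3)
proof (induction n arbitrary: e F)
  case 0
  then show ?case by (simp add: dot_def)
next
  case (Suc n)
  note [measurable] = Suc.prems(2)
  interpret N: prob_space "normal_measure \<sigma>" using assms by (intro prob_space_normal_measure)
  interpret NP: product_sigma_finite "\<lambda>_. normal_measure \<sigma>" by unfold_locales
  interpret NN: pair_sigma_finite "normal_measure \<sigma>" "normal_measure \<sigma>" by unfold_locales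
  define s where "s = e n"
  have dS: "dot (Suc n) a b = dot n a b + a n * b n" for a b by (simp add: dot_def)
  have dupd: "dot n a (b(n := x)) = dot n a b" for a b x by (simp add: dot_def)
  have tot: "dot n e e + s\<^sup>2 = 1" using Suc.prems by (simp add: dS s_def power2_eq_square)
  have nonneg: "dot n e e \<ge> 0" unfolding dot_def by (auto intro: sum_nonneg)
  have meas_upd [measurable]: "(\<lambda>(y, x). y(n := x)) \<in> PiM {..<n} (\<lambda>_. borel) \<Otimes>\<^sub>M borel \<rightarrow>\<^sub>M PiM {..<Suc n} (\<lambda>_. borel)"
    unfolding lessThan_Suc by (rule measurable_add_dim)
  show ?case
  proof (cases "dot n e e = 0")
    \<comment> \<open>Here \<open>e\<close> is plus or minus the last unit vector, so resampling
      overwrites coordinate \<open>n\<close> only, and the sign is absorbed by the symmetry of the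
      Gaussian.\<close>
    case True
    have e0: "e i = 0" if "i < n" for i
    proof -
      have "\<forall>i\<in>{..<n}. e i * e i = 0"
        using True unfolding dot_def by (subst (asm) sum_nonneg_eq_0_iff) auto
      then show ?thesis using that by simp
    qed
    have s: "s = 1 \<or> s = -1" using tot True by (simp add: power2_eq_1_iff)
    have "(\<integral>\<^sup>+y. \<integral>\<^sup>+z. F (\<lambda>i\<in>{..<Suc n}. y i + (z - dot (Suc n) e y) * e i) \<partial>normal_measure \<sigma> \<partial>normal_product (Suc n) \<sigma>) =
      (\<integral>\<^sup>+y. \<integral>\<^sup>+x. \<integral>\<^sup>+z. F (\<lambda>i\<in>{..<Suc n}. (y(n := x)) i + (z - dot (Suc n) e (y(n := x))) * e i)
         \<partial>normal_measure \<sigma> \<partial>normal_measure \<sigma> \<partial>normal_product n \<sigma>)"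
      by (rule nn_integral_normal_product_Suc) (use assms in auto)
    also have "\<dots> = (\<integral>\<^sup>+y. \<integral>\<^sup>+x. \<integral>\<^sup>+z. F (y(n := s * z)) \<partial>normal_measure \<sigma> \<partial>normal_measure \<sigma> \<partial>normal_product n \<sigma>)"
    proof (intro nn_integral_cong arg_cong[where f=F])
      fix y x z assume y: "y \<in> space (normal_product n \<sigma>)"
      have "dot n e y = 0" by (simp add: dot_def e0)
      then show "(\<lambda>i\<in>{..<Suc n}. (y(n := x)) i + (z - dot (Suc n) e (y(n := x))) * e i) = y(n := s * z)"
        using y s by (auto simp: fun_eq_iff e0 dS dupd space_PiM PiE_def extensional_def s_def[symmetric] not_less less_Suc_eq)
    qed
    also have "\<dots> = (\<integral>\<^sup>+y. \<integral>\<^sup>+z. F (y(n := s * z)) \<partial>normal_measure \<sigma> \<partial>normal_product n \<sigma>)"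
      by (simp add: N.emeasure_space_1[simplified])
    also have "\<dots> = (\<integral>\<^sup>+y. \<integral>\<^sup>+z. F (y(n := z)) \<partial>normal_measure \<sigma> \<partial>normal_product n \<sigma>)"
    proof (rule nn_integral_cong)
      fix y assume [simp]: "y \<in> space (normal_product n \<sigma>)"
      then have [simp]: "y \<in> space (PiM {..<n} (\<lambda>_. borel))" by (simp add: space_PiM)
      have "(\<lambda>z. F (y(n := z))) \<in> borel_measurable borel" by measurable
      from nn_integral_normal_measure_uminus[OF this, of \<sigma>] s
      show "(\<integral>\<^sup>+z. F (y(n := s * z)) \<partial>normal_measure \<sigma>) = (\<integral>\<^sup>+z. F (y(n := z)) \<partial>normal_measure \<sigma>)"
        by auto
    qed
    also have "\<dots> = (\<integral>\<^sup>+y. F y \<partial>normal_product (Suc n) \<sigma>)"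
      by (rule nn_integral_normal_product_Suc[symmetric]) (use assms in auto)
    finally show ?thesis by (rule sym)
  next
    case False
    define c where "c = sqrt (dot n e e)"
    have c: "c > 0" "c\<^sup>2 = dot n e e" using False nonneg by (auto simp: c_def)
    have cs: "c\<^sup>2 + s\<^sup>2 = 1" using tot c by simp
    define e' where "e' i = e i / c" for i
    have e: "e i = c * e' i" for i using c by (simp add: e'_def)
    have dote: "dot n e y = c * dot n e' y" for y by (simp add: dot_def e sum_distrib_left mult.assoc)
    have e'1: "dot n e' e' = 1"
    proof -
      have "dot n e' e' = dot n e e / c\<^sup>2"
        by (simp add: dot_def e'_def power2_eq_square sum_divide_distrib)
      then show ?thesis using c False by simp
    qed
    \<comment> \<open>\<open>R y a b\<close> evaluates \<open>F\<close> at the point that agrees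
      with \<open>y\<close> orthogonally to \<open>e'\<close>, has component \<open>a\<close> along
      \<open>e'\<close> and last coordinate \<open>b\<close>.\<close>
    define R where "R y a b = F (\<lambda>i\<in>{..<Suc n}. if i = n then b else y i + (a - dot n e' y) * e' i)" for y a b
    have upd_meas: "(\<lambda>(y, a, b). (\<lambda>i\<in>{..<Suc n}. if i = n then b else y i + (a - dot n e' y) * e' i))
        \<in> PiM {..<n} (\<lambda>_. borel) \<Otimes>\<^sub>M borel \<Otimes>\<^sub>M borel \<rightarrow>\<^sub>M PiM {..<Suc n} (\<lambda>_. borel)"
    proof (subst split_beta', subst split_beta', rule measurable_restrict)
      fix i assume "i \<in> {..<Suc n}"
      then consider "i = n" | "i \<in> {..<n}" "i \<noteq> n" by fastforce
      then show "(\<lambda>x. if i = n then snd (snd x) else fst x i + (fst (snd x) - dot n e' (fst x)) * e' i)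
         \<in> borel_measurable (PiM {..<n} (\<lambda>_. borel) \<Otimes>\<^sub>M borel \<Otimes>\<^sub>M borel)"
        by cases (simp_all, measurable)
    qed
    have R_meas [measurable]: "(\<lambda>(y, a, b). R y a b) \<in> borel_measurable (PiM {..<n} (\<lambda>_. borel) \<Otimes>\<^sub>M borel \<Otimes>\<^sub>M borel)"
      using measurable_compose[OF upd_meas Suc.prems(2)] by (simp only: R_def split_beta')
    have R_meas' [measurable (raw)]: "(\<lambda>x. R (f x) (g x) (h x)) \<in> borel_measurable L"
      if [measurable]: "f \<in> L \<rightarrow>\<^sub>M PiM {..<n} (\<lambda>_. borel)" "g \<in> borel_measurable L" "h \<in> borel_measurable L"
      for L :: "(((nat \<Rightarrow> real) \<times> real) \<times> real) measure" and f g h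
    proof -
      have "(\<lambda>x. (f x, g x, h x)) \<in> L \<rightarrow>\<^sub>M PiM {..<n} (\<lambda>_. borel) \<Otimes>\<^sub>M borel \<Otimes>\<^sub>M borel" by measurable
      from measurable_compose[OF this R_meas] show ?thesis by simp
    qed
    have R_meas2 [measurable]: "case_prod (R y) \<in> borel_measurable (borel \<Otimes>\<^sub>M borel)"
      if "y \<in> space (normal_product n \<sigma>)" for y
    proof -
      have "y \<in> space (PiM {..<n} (\<lambda>_. borel))" using that by (simp add: space_PiM)
      from measurable_compose[OF measurable_Pair1'[OF this] R_meas] show ?thesis by simp
    qed
    \<comment> \<open>The induction hypothesis makes the component along \<open>e'\<close> a fresh
      Gaussian \<open>a\<close>. After rotating \<open>(a, b)\<close>, \<open>z\<close> is the
      component along \<open>e = (c e', s)\<close>, and \<open>h\<close> is the component along the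
      unit vector orthogonal to \<open>e\<close> in the same plane.\<close>
    have LHS: "(\<integral>\<^sup>+y. F y \<partial>normal_product (Suc n) \<sigma>) =
      (\<integral>\<^sup>+y. \<integral>\<^sup>+z. \<integral>\<^sup>+h. R y (c * z - s * h) (s * z + c * h) \<partial>normal_measure \<sigma> \<partial>normal_measure \<sigma> \<partial>normal_product n \<sigma>)"
    proof -
      have "(\<integral>\<^sup>+y. F y \<partial>normal_product (Suc n) \<sigma>) =
        (\<integral>\<^sup>+y. \<integral>\<^sup>+x. F (y(n := x)) \<partial>normal_measure \<sigma> \<partial>normal_product n \<sigma>)"
        by (rule nn_integral_normal_product_Suc) (use assms in auto)
      also have "\<dots> = (\<integral>\<^sup>+y. \<integral>\<^sup>+a. \<integral>\<^sup>+x. F ((\<lambda>i\<in>{..<n}. y i + (a - dot n e' y) * e' i)(n := x))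
          \<partial>normal_measure \<sigma> \<partial>normal_measure \<sigma> \<partial>normal_product n \<sigma>)"
        by (rule Suc.IH[OF e'1]) measurable
      also have "\<dots> = (\<integral>\<^sup>+y. \<integral>\<^sup>+a. \<integral>\<^sup>+x. R y a x \<partial>normal_measure \<sigma> \<partial>normal_measure \<sigma> \<partial>normal_product n \<sigma>)"
        unfolding R_def by (intro nn_integral_cong arg_cong[where f=F]) (auto simp: fun_eq_iff)
      also have "\<dots> = (\<integral>\<^sup>+y. \<integral>\<^sup>+z. \<integral>\<^sup>+h. R y (c * z - s * h) (s * z + c * h) \<partial>normal_measure \<sigma> \<partial>normal_measure \<sigma> \<partial>normal_product n \<sigma>)"
        by (intro nn_integral_cong nn_integral_normal_rotate R_meas2 cs c)
      finally show ?thesis .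
    qed
    let ?R = "\<lambda>y z h. R y (c * z - s * h) (s * z + c * h)"
    have "(\<integral>\<^sup>+y. \<integral>\<^sup>+z. F (\<lambda>i\<in>{..<Suc n}. y i + (z - dot (Suc n) e y) * e i) \<partial>normal_measure \<sigma> \<partial>normal_product (Suc n) \<sigma>) =
      (\<integral>\<^sup>+y. \<integral>\<^sup>+x. \<integral>\<^sup>+z. F (\<lambda>i\<in>{..<Suc n}. (y(n := x)) i + (z - dot (Suc n) e (y(n := x))) * e i)
         \<partial>normal_measure \<sigma> \<partial>normal_measure \<sigma> \<partial>normal_product n \<sigma>)"
      by (rule nn_integral_normal_product_Suc) (use assms in auto)
    \<comment> \<open>The shift along \<open>e\<close> sets the component along \<open>e\<close> to
      \<open>z\<close> and keeps the orthogonal one, which is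
      \<open>c * x - s * dot n e' y\<close>.\<close>
    also have "\<dots> = (\<integral>\<^sup>+y. \<integral>\<^sup>+x. \<integral>\<^sup>+z. ?R y z (c * x - s * dot n e' y)
         \<partial>normal_measure \<sigma> \<partial>normal_measure \<sigma> \<partial>normal_product n \<sigma>)"
      unfolding R_def
    proof (intro nn_integral_cong arg_cong[where f=F] ext)
      fix y x z i
      have s2: "s * (s * t) = t - c * (c * t)" for t
        using cs by (simp add: power2_eq_square algebra_simps flip: distrib_right)
          (metis distrib_right mult.assoc mult_1 add.commute)
      show "(\<lambda>i\<in>{..<Suc n}. (y(n := x)) i + (z - dot (Suc n) e (y(n := x))) * e i) i =
        (\<lambda>i\<in>{..<Suc n}. if i = n then s * z + c * (c * x - s * dot n e' y)
          else y i + (c * z - s * (c * x - s * dot n e' y) - dot n e' y) * e' i) i"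
        unfolding dS dupd dote
        by (auto simp: s_def[symmetric] algebra_simps s2) (auto simp: e algebra_simps s2)
    qed
    also have "\<dots> = (\<integral>\<^sup>+y. \<integral>\<^sup>+a. \<integral>\<^sup>+x. \<integral>\<^sup>+z. ?R y z (c * x - s * a)
         \<partial>normal_measure \<sigma> \<partial>normal_measure \<sigma> \<partial>normal_measure \<sigma> \<partial>normal_product n \<sigma>)"
    proof (subst Suc.IH[OF e'1])
      have "R (\<lambda>i\<in>{..<n}. y i + (a - dot n e' y) * e' i) = R y" for y a
        unfolding R_def dot_line e'1
        by (intro ext arg_cong[where f=F]) (auto simp: fun_eq_iff algebra_simps)
      then show "(\<integral>\<^sup>+y. \<integral>\<^sup>+a. \<integral>\<^sup>+x. \<integral>\<^sup>+z. ?R (\<lambda>i\<in>{..<n}. y i + (a - dot n e' y) * e' i) z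
             (c * x - s * dot n e' (\<lambda>i\<in>{..<n}. y i + (a - dot n e' y) * e' i))
         \<partial>normal_measure \<sigma> \<partial>normal_measure \<sigma> \<partial>normal_measure \<sigma> \<partial>normal_product n \<sigma>) =
         (\<integral>\<^sup>+y. \<integral>\<^sup>+a. \<integral>\<^sup>+x. \<integral>\<^sup>+z. ?R y z (c * x - s * a)
         \<partial>normal_measure \<sigma> \<partial>normal_measure \<sigma> \<partial>normal_measure \<sigma> \<partial>normal_product n \<sigma>)"
        by (simp add: dot_line e'1)
    qed measurable
    \<comment> \<open>After rotating \<open>(a, x)\<close> the old orthogonal component is
      \<open>h\<close> alone, so the integral over \<open>z'\<close> becomes trivial and only the
      order of \<open>h\<close> and \<open>z\<close> differs from \<open>LHS\<close>.\<close>
    also have "\<dots> = (\<integral>\<^sup>+y. \<integral>\<^sup>+z'. \<integral>\<^sup>+h. \<integral>\<^sup>+z. ?R y z (c * (s * z' + c * h) - s * (c * z' - s * h))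
         \<partial>normal_measure \<sigma> \<partial>normal_measure \<sigma> \<partial>normal_measure \<sigma> \<partial>normal_product n \<sigma>)"
    proof (rule nn_integral_cong)
      fix y assume [measurable]: "y \<in> space (normal_product n \<sigma>)"
      show "(\<integral>\<^sup>+a. \<integral>\<^sup>+x. \<integral>\<^sup>+z. ?R y z (c * x - s * a) \<partial>normal_measure \<sigma> \<partial>normal_measure \<sigma> \<partial>normal_measure \<sigma>) =
        (\<integral>\<^sup>+z'. \<integral>\<^sup>+h. \<integral>\<^sup>+z. ?R y z (c * (s * z' + c * h) - s * (c * z' - s * h)) \<partial>normal_measure \<sigma> \<partial>normal_measure \<sigma> \<partial>normal_measure \<sigma>)"
        by (rule nn_integral_normal_rotate[OF _ cs c(1)]) measurable
    qed
    also have "\<dots> = (\<integral>\<^sup>+y. \<integral>\<^sup>+z'. \<integral>\<^sup>+h. \<integral>\<^sup>+z. ?R y z h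
         \<partial>normal_measure \<sigma> \<partial>normal_measure \<sigma> \<partial>normal_measure \<sigma> \<partial>normal_product n \<sigma>)"
    proof -
      have "c * (s * z' + c * h) - s * (c * z' - s * h) = (c\<^sup>2 + s\<^sup>2) * h" for z' h
        by (simp add: power2_eq_square algebra_simps)
      then show ?thesis unfolding cs by simp
    qed
    also have "\<dots> = (\<integral>\<^sup>+y. \<integral>\<^sup>+h. \<integral>\<^sup>+z. ?R y z h \<partial>normal_measure \<sigma> \<partial>normal_measure \<sigma> \<partial>normal_product n \<sigma>)"
      by (simp add: N.emeasure_space_1[simplified])
    also have "\<dots> = (\<integral>\<^sup>+y. \<integral>\<^sup>+z. \<integral>\<^sup>+h. ?R y z h \<partial>normal_measure \<sigma> \<partial>normal_measure \<sigma> \<partial>normal_product n \<sigma>)"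
    proof (rule nn_integral_cong)
      fix y assume [measurable]: "y \<in> space (normal_product n \<sigma>)"
      show "(\<integral>\<^sup>+h. \<integral>\<^sup>+z. ?R y z h \<partial>normal_measure \<sigma> \<partial>normal_measure \<sigma>) =
         (\<integral>\<^sup>+z. \<integral>\<^sup>+h. ?R y z h \<partial>normal_measure \<sigma> \<partial>normal_measure \<sigma>)"
        by (rule NN.Fubini') measurable
    qed
    finally show ?thesis unfolding LHS by (rule sym)
  qed
qed

section \<open>Conditioning on all but one direction\<close>

definition line_shift :: "nat \<Rightarrow> (nat \<Rightarrow> real) \<Rightarrow> real \<Rightarrow> (nat \<Rightarrow> real) \<Rightarrow> nat \<Rightarrow> real" where
  "line_shift n e t y = (\<lambda>i\<in>{..<n}. y i + t * e i)"

lemma dot_line_shift: "dot n a (line_shift n e t y) = dot n a y + t * dot n a e"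
  unfolding line_shift_def by (rule dot_line)

lemma dot_scale: "dot n (\<lambda>i. c * a i) b = c * dot n a b" "dot n a (\<lambda>i. c * b i) = c * dot n a b"
  by (simp_all add: dot_def sum_distrib_left algebra_simps)

lemma dot_commute: "dot n a b = dot n b a"
  by (simp add: dot_def mult.commute)

lemma dot_comb:
  "dot n (\<lambda>i. a i - c * b i) (\<lambda>i. a i - c * b i) = dot n a a - 2 * c * dot n a b + c\<^sup>2 * dot n b b"
  by (simp add: dot_def sum_subtractf sum.distrib sum_distrib_left algebra_simps power2_eq_square)

lemma dot_self_nonneg: "0 \<le> dot n a a"
  by (simp add: dot_def sum_nonneg)

lemma measurable_line_shift [measurable]:
  assumes [measurable]: "f \<in> borel_measurable L" "g \<in> L \<rightarrow>\<^sub>M PiM {..<n} (\<lambda>_. borel)"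
  shows "(\<lambda>x. line_shift n e (f x) (g x)) \<in> L \<rightarrow>\<^sub>M PiM {..<n} (\<lambda>_. borel)"
  unfolding line_shift_def by (rule measurable_restrict) simp

lemma prob_space_normal_product: "0 < \<sigma> \<Longrightarrow> prob_space (normal_product n \<sigma>)"
  by (intro prob_space_PiM prob_space_normal_measure)

lemma space_normal_product: "space (normal_product n \<sigma>) = space (PiM {..<n} (\<lambda>_. borel))"
  by (simp add: space_PiM)

lemma measurable_measure_normal [measurable (raw)]:
  assumes "0 < \<sigma>" and Q[measurable]: "Measurable.pred (L \<Otimes>\<^sub>M borel) (\<lambda>(y, z). Q y z)"
  shows "(\<lambda>y. measure (normal_measure \<sigma>) {z. Q y z}) \<in> borel_measurable L"
proof -
  interpret N: prob_space "normal_measure \<sigma>" using assms by (intro prob_space_normal_measure)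
  have "(\<lambda>y. enn2real (\<integral>\<^sup>+z. (if Q y z then 1 else 0) \<partial>normal_measure \<sigma>)) \<in> borel_measurable L"
    by measurable
  moreover have "enn2real (\<integral>\<^sup>+z. (if Q y z then 1 else 0) \<partial>normal_measure \<sigma>) = measure (normal_measure \<sigma>) {z. Q y z}"
    if y: "y \<in> space L" for y
  proof -
    have [measurable]: "Measurable.pred borel (Q y)"
      using measurable_compose[OF measurable_Pair1'[OF y] Q] by simp
    have "(\<integral>\<^sup>+z. (if Q y z then 1 else 0) \<partial>normal_measure \<sigma>) = (\<integral>\<^sup>+z. indicator {z. Q y z} z \<partial>normal_measure \<sigma>)"
      by (intro nn_integral_cong) (auto simp: indicator_def)
    then show ?thesis by (simp add: measure_def)
  qed
  ultimately show ?thesis by (simp cong: measurable_cong)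
qed

text \<open>This is Fubini along the direction \<open>e\<close>: the resampling identity applied to
  an indicator, with the inner integral being the Gaussian measure of a section of the
  event.\<close>

lemma measure_normal_product_resample:
  assumes "0 < \<sigma>" "dot n e e = 1" and [measurable]: "Measurable.pred (PiM {..<n} (\<lambda>_. borel)) Q"
  shows "measure (normal_product n \<sigma>) {y \<in> space (normal_product n \<sigma>). Q y} =
    (\<integral>y. measure (normal_measure \<sigma>) {z. Q (line_shift n e (z - dot n e y) y)} \<partial>normal_product n \<sigma>)"
proof -
  let ?P = "normal_product n \<sigma>" and ?N = "normal_measure \<sigma>"
  interpret N: prob_space "normal_measure \<sigma>" using assms by (intro prob_space_normal_measure)
  interpret P: prob_space ?P using assms by (intro prob_space_normal_product)
  have "emeasure ?P {y \<in> space ?P. Q y} = (\<integral>\<^sup>+y. (if Q y then 1 else 0) \<partial>?P)"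
  proof -
    have "(\<integral>\<^sup>+y. (if Q y then 1 else 0) \<partial>?P) = (\<integral>\<^sup>+y. indicator {y \<in> space ?P. Q y} y \<partial>?P)"
      by (intro nn_integral_cong) (simp add: indicator_def)
    then show ?thesis by simp
  qed
  also have "\<dots> = (\<integral>\<^sup>+y. \<integral>\<^sup>+z. (if Q (line_shift n e (z - dot n e y) y) then 1 else 0) \<partial>?N \<partial>?P)"
    unfolding line_shift_def using assms(1,2) by (rule nn_integral_normal_product_resample) measurable
  also have "\<dots> = (\<integral>\<^sup>+y. ennreal (measure ?N {z. Q (line_shift n e (z - dot n e y) y)}) \<partial>?P)"
  proof (rule nn_integral_cong)
    fix y assume "y \<in> space ?P"
    then have [measurable]: "y \<in> space (PiM {..<n} (\<lambda>_. borel))" by (simp add: space_PiM)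
    have "(\<integral>\<^sup>+z. (if Q (line_shift n e (z - dot n e y) y) then 1 else 0) \<partial>?N)
      = (\<integral>\<^sup>+z. indicator {z. Q (line_shift n e (z - dot n e y) y)} z \<partial>?N)"
      by (intro nn_integral_cong) (auto simp: indicator_def)
    also have "\<dots> = ennreal (measure ?N {z. Q (line_shift n e (z - dot n e y) y)})"
      by (subst nn_integral_indicator) (auto simp: N.emeasure_eq_measure)
    finally show "(\<integral>\<^sup>+z. (if Q (line_shift n e (z - dot n e y) y) then 1 else 0) \<partial>?N)
      = ennreal (measure ?N {z. Q (line_shift n e (z - dot n e y) y)})" .
  qed
  finally have "emeasure ?P {y \<in> space ?P. Q y} =
    (\<integral>\<^sup>+y. ennreal (measure ?N {z. Q (line_shift n e (z - dot n e y) y)}) \<partial>?P)" .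
  then have "measure ?P {y \<in> space ?P. Q y} =
    enn2real (\<integral>\<^sup>+y. ennreal (measure ?N {z. Q (line_shift n e (z - dot n e y) y)}) \<partial>?P)"
    by (simp add: measure_def)
  also have "\<dots> = (\<integral>y. measure ?N {z. Q (line_shift n e (z - dot n e y) y)} \<partial>?P)"
    by (rule integral_eq_nn_integral[symmetric])
       (use assms in \<open>auto intro!: measurable_measure_normal\<close>)
  finally show ?thesis .
qed

lemma integrable_measure_normal:
  assumes "0 < \<sigma>" "Measurable.pred (PiM {..<n} (\<lambda>_. borel) \<Otimes>\<^sub>M borel) (\<lambda>(y, z). Q y z)"
  shows "integrable (normal_product n \<sigma>) (\<lambda>y. measure (normal_measure \<sigma>) {z. Q y z})"
proof -
  interpret N: prob_space "normal_measure \<sigma>" using assms by (intro prob_space_normal_measure)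
  interpret P: prob_space "normal_product n \<sigma>" using assms by (intro prob_space_normal_product)
  have "(\<lambda>y. measure (normal_measure \<sigma>) {z. Q y z}) \<in> borel_measurable (normal_product n \<sigma>)"
    by (subst measurable_cong_sets[OF sets_normal_product refl])
       (intro measurable_measure_normal assms)
  then show ?thesis
    by (intro P.integrable_const_bound[where B=1]) auto
qed

text \<open>After resampling along the normalised direction of \<open>a\<close>, the linear form
  becomes \<open>q * z\<close> with \<open>q > 0\<close>, and a single point has Gaussian measure
  0.\<close>

lemma AE_normal_product_dot_nonzero:
  assumes "0 < \<sigma>" "dot n a a \<noteq> 0"
  shows "AE y in normal_product n \<sigma>. dot n a y \<noteq> 0"
proof -
  interpret P: prob_space "normal_product n \<sigma>" using assms by (intro prob_space_normal_product)
  interpret N: prob_space "normal_measure \<sigma>" using assms by (intro prob_space_normal_measure)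
  define q where "q = sqrt (dot n a a)"
  define e where "e i = (1/q) * a i" for i
  have q: "q > 0" "q\<^sup>2 = dot n a a" using assms dot_self_nonneg[of n a] by (auto simp: q_def)
  have "dot n e e = dot n a a / q\<^sup>2" unfolding e_def dot_scale by (simp add: power2_eq_square)
  then have e: "dot n e e = 1" using q assms by simp
  have dae: "dot n a y = q * dot n e y" for y
    using q dot_scale(1)[of n "1/q" a y] by (simp only: e_def[abs_def]) simp
  have "N.prob {z. q * z = 0} = 0"
  proof -
    have "{z. q * z = 0} = {0}" using q by auto
    moreover have "emeasure (normal_measure \<sigma>) {0} = 0"
      by (subst emeasure_density) (auto simp: nn_integral_indicator_singleton')
    ultimately show ?thesis by (simp add: measure_def)
  qed
  moreover have "dot n a (line_shift n e (z - dot n e y) y) = q * z" for z y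
    unfolding dae dot_line_shift e by (simp add: algebra_simps)
  ultimately have "P.prob {y \<in> space (normal_product n \<sigma>). dot n a y = 0} = 0"
    by (subst measure_normal_product_resample[OF assms(1) e]) (simp_all del: mult_eq_0_iff)
  then show ?thesis
    by (subst AE_iff_measurable[OF _ refl]) (auto simp: P.emeasure_eq_measure)
qed

section \<open>Gaussian tails\<close>

definition upper_tail :: "real \<Rightarrow> real \<Rightarrow> real" where
  "upper_tail \<sigma> x = measure (normal_measure \<sigma>) {x<..}"

lemma normal_density_shift:
  assumes "0 < \<sigma>"
  shows "normal_density 0 \<sigma> (a + x) = exp (- (2 * a * x + a\<^sup>2) / (2 * \<sigma>\<^sup>2)) * normal_density 0 \<sigma> x"
proof -
  have "- (a + x)\<^sup>2 / (2 * \<sigma>\<^sup>2) = - (2 * a * x + a\<^sup>2) / (2 * \<sigma>\<^sup>2) + - x\<^sup>2 / (2 * \<sigma>\<^sup>2)"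
    by (simp add: power2_eq_square algebra_simps add_divide_distrib diff_divide_distrib)
  then show ?thesis by (simp add: normal_density_def exp_add[symmetric])
qed

text \<open>Translating the Gaussian by \<open>a\<close> multiplies its density by an exponential
  weight. Comparing two tails thereby reduces to bounding this weight pointwise.\<close>

lemma emeasure_upper_tail_shift:
  assumes "0 < \<sigma>"
  shows "emeasure (normal_measure \<sigma>) {m + a<..} =
    (\<integral>\<^sup>+x. ennreal (exp (- (2 * a * x + a\<^sup>2) / (2 * \<sigma>\<^sup>2))) * indicator {m<..} x \<partial>normal_measure \<sigma>)"
proof -
  have "emeasure (normal_measure \<sigma>) {m + a<..} =
    (\<integral>\<^sup>+x. ennreal (normal_density 0 \<sigma> x) * indicator {m + a<..} x \<partial>lborel)"
    by (rule emeasure_density) auto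
  also have "\<dots> = (\<integral>\<^sup>+x. ennreal (normal_density 0 \<sigma> (a + x)) * indicator {m + a<..} (a + x) \<partial>lborel)"
    by (subst nn_integral_real_affine[where c=1 and t=a]) auto
  also have "\<dots> = (\<integral>\<^sup>+x. ennreal (normal_density 0 \<sigma> x) *
      (ennreal (exp (- (2 * a * x + a\<^sup>2) / (2 * \<sigma>\<^sup>2))) * indicator {m<..} x) \<partial>lborel)"
    unfolding normal_density_shift[OF assms]
    by (intro nn_integral_cong) (auto simp: indicator_def ennreal_mult' mult.commute)
  also have "\<dots> = (\<integral>\<^sup>+x. ennreal (exp (- (2 * a * x + a\<^sup>2) / (2 * \<sigma>\<^sup>2))) * indicator {m<..} x \<partial>normal_measure \<sigma>)"
    by (subst nn_integral_density) auto
  finally show ?thesis .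
qed

lemma upper_tail_shift_le:
  assumes "0 < \<sigma>" "0 \<le> a" "0 \<le> m"
  shows "upper_tail \<sigma> (m + a) \<le> exp (- (a * m) / \<sigma>\<^sup>2) * upper_tail \<sigma> m"
proof -
  interpret N: prob_space "normal_measure \<sigma>" using assms by (intro prob_space_normal_measure)
  have "emeasure (normal_measure \<sigma>) {m + a<..} \<le>
    (\<integral>\<^sup>+x. ennreal (exp (- (a * m) / \<sigma>\<^sup>2)) * indicator {m<..} x \<partial>normal_measure \<sigma>)"
    unfolding emeasure_upper_tail_shift[OF assms(1)]
  proof (rule nn_integral_mono)
    fix x
    show "ennreal (exp (- (2 * a * x + a\<^sup>2) / (2 * \<sigma>\<^sup>2))) * indicator {m<..} x \<le>
      ennreal (exp (- (a * m) / \<sigma>\<^sup>2)) * indicator {m<..} x"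
    proof (cases "m < x")
      case True
      then have "a * m \<le> a * x" using assms by (intro mult_left_mono) auto
      then have "2 * (a * m) \<le> 2 * a * x + a\<^sup>2" by (simp add: add_increasing2)
      then have "2 * (a * m) / (2 * \<sigma>\<^sup>2) \<le> (2 * a * x + a\<^sup>2) / (2 * \<sigma>\<^sup>2)" by (intro divide_right_mono) auto
      then have "- (2 * a * x + a\<^sup>2) / (2 * \<sigma>\<^sup>2) \<le> - (a * m) / \<sigma>\<^sup>2"
        unfolding minus_divide_left[symmetric] by simp
      then show ?thesis using True by (simp only: indicator_def) simp
    qed simp
  qed
  also have "\<dots> = ennreal (exp (- (a * m) / \<sigma>\<^sup>2)) * emeasure (normal_measure \<sigma>) {m<..}"
    by (rule nn_integral_cmult_indicator) simp
  finally show ?thesis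
    by (simp add: upper_tail_def N.emeasure_eq_measure flip: ennreal_mult)
qed

text \<open>The weight decreases in \<open>x\<close>, so it has a useful lower bound only on the
  window from \<open>m\<close> to \<open>m + h\<close>; discarding everything beyond the window
  costs the subtracted tail.\<close>

lemma upper_tail_shift_ge:
  assumes "0 < \<sigma>" "0 \<le> a" "0 \<le> h"
  shows "exp (- (2 * a * (m + h) + a\<^sup>2) / (2 * \<sigma>\<^sup>2)) * (upper_tail \<sigma> m - upper_tail \<sigma> (m + h))
    \<le> upper_tail \<sigma> (m + a)"
proof -
  interpret N: prob_space "normal_measure \<sigma>" using assms by (intro prob_space_normal_measure)
  let ?K = "exp (- (2 * a * (m + h) + a\<^sup>2) / (2 * \<sigma>\<^sup>2))"
  have "ennreal ?K * emeasure (normal_measure \<sigma>) {m<..m + h}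
    = (\<integral>\<^sup>+x. ennreal ?K * indicator {m<..m + h} x \<partial>normal_measure \<sigma>)"
    by (rule nn_integral_cmult_indicator[symmetric]) simp
  also have "\<dots> \<le> emeasure (normal_measure \<sigma>) {m + a<..}"
    unfolding emeasure_upper_tail_shift[OF assms(1)]
  proof (rule nn_integral_mono)
    fix x
    show "ennreal ?K * indicator {m<..m + h} x \<le>
      ennreal (exp (- (2 * a * x + a\<^sup>2) / (2 * \<sigma>\<^sup>2))) * indicator {m<..} x"
    proof (cases "m < x \<and> x \<le> m + h")
      case True
      then have "a * x \<le> a * (m + h)" using assms by (intro mult_left_mono) auto
      then have "(2 * a * x + a\<^sup>2) / (2 * \<sigma>\<^sup>2) \<le> (2 * a * (m + h) + a\<^sup>2) / (2 * \<sigma>\<^sup>2)"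
        by (intro divide_right_mono) auto
      then have "- (2 * a * (m + h) + a\<^sup>2) / (2 * \<sigma>\<^sup>2) \<le> - (2 * a * x + a\<^sup>2) / (2 * \<sigma>\<^sup>2)"
        unfolding minus_divide_left[symmetric] by simp
      then show ?thesis using True by (simp only: indicator_def) simp
    qed simp
  qed
  finally have "?K * N.prob {m<..m + h} \<le> N.prob {m + a<..}"
    by (simp add: N.emeasure_eq_measure flip: ennreal_mult)
  moreover have "N.prob {m<..m + h} = N.prob {m<..} - N.prob {m + h<..}"
    using assms by (subst N.finite_measure_Diff[symmetric]) (auto intro!: arg_cong[where f=N.prob])
  ultimately show ?thesis by (simp add: upper_tail_def)
qed

text \<open>The conditional probability, given the runner-up value \<open>m\<close>, that one fixed
  signed index wins and its statistic, before division by the variance, exceeds \<open>t\<close>.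
  For \<open>m \<ge> 0\<close> and \<open>t = 0\<close> the second condition follows from the first,
  leaving the probability of winning.\<close>

definition gap_tail :: "real \<Rightarrow> real \<Rightarrow> real \<Rightarrow> real" where
  "gap_tail \<sigma> t m = measure (normal_measure \<sigma>) {z. m < z \<and> t < z * (z - m)}"

lemma gap_tail_eq_upper_tail:
  assumes "0 < m" "0 \<le> t"
  shows "gap_tail \<sigma> t m = upper_tail \<sigma> (m + (sqrt (m\<^sup>2 + 4 * t) - m) / 2)"
proof -
  \<comment> \<open>The larger root of \<open>z * (z - m) = t\<close>.\<close>
  define z0 where "z0 = m + (sqrt (m\<^sup>2 + 4 * t) - m) / 2"
  have "sqrt (m\<^sup>2 + 4 * t) \<ge> m" using assms by (intro real_le_rsqrt) auto
  then have z0: "z0 \<ge> m" by (simp add: z0_def)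
  have "z0 * (z0 - m) = ((sqrt (m\<^sup>2 + 4 * t))\<^sup>2 - m\<^sup>2) / 4"
    by (simp add: z0_def power2_eq_square field_simps)
  also have "\<dots> = t" using assms by simp
  finally have z0t: "z0 * (z0 - m) = t" .
  have "{z. m < z \<and> t < z * (z - m)} = {z0<..}"
  proof (intro Set.set_eqI iffI)
    fix z assume "z \<in> {z. m < z \<and> t < z * (z - m)}"
    then have z: "m < z" "t < z * (z - m)" by auto
    have "z0 < z"
    proof (rule ccontr)
      assume "\<not> z0 < z"
      then have "z * (z - m) \<le> z0 * (z0 - m)" using z assms by (intro mult_mono) auto
      then show False using z z0t by simp
    qed
    then show "z \<in> {z0<..}" by simp
  next
    fix z assume "z \<in> {z0<..}"
    then have z: "z0 < z" by simp
    have "z0 * (z0 - m) \<le> z0 * (z - m)" using z z0 assms by (intro mult_left_mono) auto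
    also have "\<dots> < z * (z - m)" using z z0 assms by (intro mult_strict_right_mono) auto
    finally show "z \<in> {z. m < z \<and> t < z * (z - m)}" using z z0 z0t by auto
  qed
  then show ?thesis by (simp add: gap_tail_def upper_tail_def z0_def)
qed

text \<open>The root exceeds \<open>m\<close> by \<open>a m\<close>, where \<open>a m * m\<close>
  tends to \<open>t * \<sigma>\<^sup>2\<close> and \<open>a m\<close> to 0. The weight bounds
  squeeze the ratio of the two tails between \<open>L m\<close> and \<open>U m\<close>, and both
  tend to \<open>exp (- t)\<close>.\<close>

lemma gap_tail_ratio:
  assumes "0 < \<sigma>" "0 \<le> t" "0 < \<epsilon>"
  obtains m0 where "0 < m0"
    "\<And>m. m0 \<le> m \<Longrightarrow> \<bar>gap_tail \<sigma> (t * \<sigma>\<^sup>2) m - exp (- t) * gap_tail \<sigma> 0 m\<bar> \<le> \<epsilon> * gap_tail \<sigma> 0 m"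
proof -
  define a where "a m = (sqrt (m\<^sup>2 + 4 * (t * \<sigma>\<^sup>2)) - m) / 2" for m
  define U where "U m = exp (- (a m * m) / \<sigma>\<^sup>2)" for m
  \<comment> \<open>The window has length 1; the tail beyond it is at most a fraction
    \<open>exp (- m / \<sigma>\<^sup>2)\<close> of the tail from \<open>m\<close>, whence the last
    factor.\<close>
  define L where "L m = exp (- (2 * a m * (m + 1) + (a m)\<^sup>2) / (2 * \<sigma>\<^sup>2)) * (1 - exp (- m / \<sigma>\<^sup>2))" for m
  have am: "((\<lambda>m. a m * m) \<longlongrightarrow> t * \<sigma>\<^sup>2) at_top" and a0: "(a \<longlongrightarrow> 0) at_top"
  proof -
    define k where "k = t * \<sigma>\<^sup>2"
    have "k \<ge> 0" using assms by (simp add: k_def)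
    then consider "k = 0" | "k > 0" by linarith
    then show "((\<lambda>m. a m * m) \<longlongrightarrow> t * \<sigma>\<^sup>2) at_top" "(a \<longlongrightarrow> 0) at_top"
    proof (atomize (full), cases)
      case 1
      have "eventually (\<lambda>m. a m = 0) at_top"
        using eventually_ge_at_top[of 0] by eventually_elim (use 1 in \<open>simp add: a_def k_def[symmetric]\<close>)
      then have "eventually (\<lambda>m. 0 = a m * m) at_top" "eventually (\<lambda>m. 0 = a m) at_top"
        by (eventually_elim; simp)+
      then show "((\<lambda>m. a m * m) \<longlongrightarrow> t * \<sigma>\<^sup>2) at_top \<and> (a \<longlongrightarrow> 0) at_top"
        using 1 k_def by (auto intro: Lim_transform_eventually[OF tendsto_const])
    next
      case 2
      have "((\<lambda>m. (sqrt (m\<^sup>2 + 4 * k) - m) / 2 * m) \<longlongrightarrow> k) at_top" using 2 by real_asymp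
      moreover have "((\<lambda>m. (sqrt (m\<^sup>2 + 4 * k) - m) / 2) \<longlongrightarrow> 0) at_top" using 2 by real_asymp
      ultimately show "((\<lambda>m. a m * m) \<longlongrightarrow> t * \<sigma>\<^sup>2) at_top \<and> (a \<longlongrightarrow> 0) at_top"
        unfolding a_def k_def by simp
    qed
  qed
  have Ulim: "(U \<longlongrightarrow> exp (- t)) at_top"
  proof -
    have "((\<lambda>m. exp (- (a m * m) / \<sigma>\<^sup>2)) \<longlongrightarrow> exp (- (t * \<sigma>\<^sup>2) / \<sigma>\<^sup>2)) at_top"
      using assms by (intro tendsto_intros am) auto
    then show ?thesis using assms by (simp add: U_def[abs_def])
  qed
  have Llim: "(L \<longlongrightarrow> exp (- t)) at_top"
  proof -
    have e0: "((\<lambda>m. exp (- m / \<sigma>\<^sup>2)) \<longlongrightarrow> 0) at_top" using assms by real_asymp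
    have "((\<lambda>m. exp (- (2 * (a m * m) + 2 * a m + (a m)\<^sup>2) / (2 * \<sigma>\<^sup>2)) * (1 - exp (- m / \<sigma>\<^sup>2)))
       \<longlongrightarrow> exp (- (2 * (t * \<sigma>\<^sup>2) + 2 * 0 + 0\<^sup>2) / (2 * \<sigma>\<^sup>2)) * (1 - 0)) at_top"
      using assms by (intro tendsto_intros am a0 e0) auto
    then show ?thesis using assms by (simp add: L_def[abs_def] algebra_simps)
  qed
  have "eventually (\<lambda>m. U m < exp (- t) + \<epsilon>) at_top" using order_tendstoD(2)[OF Ulim] assms by simp
  moreover have "eventually (\<lambda>m. exp (- t) - \<epsilon> < L m) at_top" using order_tendstoD(1)[OF Llim] assms by simp
  ultimately have "eventually (\<lambda>m. U m < exp (- t) + \<epsilon> \<and> exp (- t) - \<epsilon> < L m) at_top" by eventually_elim auto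
  then obtain m1 where m1: "\<And>m. m \<ge> m1 \<Longrightarrow> U m < exp (- t) + \<epsilon> \<and> exp (- t) - \<epsilon> < L m"
    by (auto simp: eventually_at_top_linorder)
  show thesis
  proof (rule that[of "max m1 1"])
    fix m assume "max m1 1 \<le> m"
    then have m: "m \<ge> m1" "m > 0" by auto
    have a: "a m \<ge> 0" unfolding a_def using m assms by (auto intro!: real_le_rsqrt)
    let ?T = "upper_tail \<sigma> m"
    have T0: "?T \<ge> 0" by (simp add: upper_tail_def)
    have 0: "gap_tail \<sigma> 0 m = ?T" using gap_tail_eq_upper_tail[of m 0 \<sigma>] m by simp
    have 1: "gap_tail \<sigma> (t * \<sigma>\<^sup>2) m = upper_tail \<sigma> (m + a m)"
      using gap_tail_eq_upper_tail[of m "t * \<sigma>\<^sup>2" \<sigma>] m assms by (simp add: a_def)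
    have up: "upper_tail \<sigma> (m + a m) \<le> U m * ?T"
      unfolding U_def using a m assms by (intro upper_tail_shift_le) auto
    have "upper_tail \<sigma> (m + 1) \<le> exp (- m / \<sigma>\<^sup>2) * ?T"
      using upper_tail_shift_le[of \<sigma> 1 m] m assms by simp
    then have "(1 - exp (- m / \<sigma>\<^sup>2)) * ?T \<le> ?T - upper_tail \<sigma> (m + 1)" by (simp add: algebra_simps)
    then have "L m * ?T \<le> exp (- (2 * a m * (m + 1) + (a m)\<^sup>2) / (2 * \<sigma>\<^sup>2)) * (?T - upper_tail \<sigma> (m + 1))"
      unfolding L_def mult.assoc by (intro mult_left_mono) auto
    also have "\<dots> \<le> upper_tail \<sigma> (m + a m)" using a assms by (intro upper_tail_shift_ge) auto
    finally have lo: "L m * ?T \<le> upper_tail \<sigma> (m + a m)" .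
    have "U m * ?T \<le> (exp (- t) + \<epsilon>) * ?T" "(exp (- t) - \<epsilon>) * ?T \<le> L m * ?T"
      using m1[OF m(1)] T0 by (auto intro!: mult_right_mono)
    then show "\<bar>gap_tail \<sigma> (t * \<sigma>\<^sup>2) m - exp (- t) * gap_tail \<sigma> 0 m\<bar> \<le> \<epsilon> * gap_tail \<sigma> 0 m"
      unfolding 0 1 using up lo by (simp add: abs_le_iff algebra_simps)
  qed simp
qed

section \<open>The winning index and the runner-up\<close>

text \<open>
  While \<open>j\<close> is the only active variable, with sign \<open>s\<close>, the correlation of the residual with \<open>X\<^sub>k\<close> reaches
  \<open>s' \<lambda>\<close> when \<open>\<lambda>\<close> equals the value below.
\<close>
definition entry_value :: "(nat \<Rightarrow> nat \<Rightarrow> real) \<Rightarrow> (nat \<Rightarrow> real) \<Rightarrow> nat \<Rightarrow> real \<Rightarrow> nat \<times> real \<Rightarrow> real" where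
  "entry_value R U j s = (\<lambda>(k, s'). s' * (U k - R k j * U j) / (1 - s * s' * R k j))"

definition runner_up :: "(nat \<Rightarrow> nat \<Rightarrow> real) \<Rightarrow> nat \<Rightarrow> (nat \<Rightarrow> real) \<Rightarrow> nat \<Rightarrow> real \<Rightarrow> real" where
  "runner_up R p U j s = Max (entry_value R U j s ` (({..<p} - {j}) \<times> {1, - 1}))"

lemma sign_mult_bound:
  fixes a :: real
  assumes "\<bar>a\<bar> < 1" "s \<in> {1, - 1}" "s' \<in> {1, - 1}"
  shows "0 < 1 - s * s' * a" "1 - s * s' * a < 2"
  using assms by (auto simp: abs_less_iff)

lemma runner_up_ge:
  assumes "k < p" "k \<noteq> j" "s' \<in> {1, - 1}"
  shows "entry_value R U j s (k, s') \<le> runner_up R p U j s"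
  unfolding runner_up_def using assms by (intro Max_ge) auto

text \<open>Choose the sign \<open>s'\<close> that makes the numerator of the entry value equal to
  the absolute residual; the denominator is less than 2.\<close>

lemma abs_residual_le_runner_up:
  assumes "k < p" "k \<noteq> j" "\<bar>R k j\<bar> < 1" "s \<in> {1, - 1}"
  shows "\<bar>U k - R k j * U j\<bar> \<le> 2 * runner_up R p U j s"
proof -
  let ?V = "U k - R k j * U j"
  obtain s' :: real where s': "s' \<in> {1, - 1}" "s' * ?V = \<bar>?V\<bar>"
    by (cases "?V \<ge> 0") (force, force)
  note b = sign_mult_bound[OF assms(3,4) s'(1)]
  have "\<bar>?V\<bar> / 2 \<le> \<bar>?V\<bar> / (1 - s * s' * R k j)" using b by (intro divide_left_mono) auto
  also have "\<dots> = entry_value R U j s (k, s')" using s' by (simp add: entry_value_def)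
  also have "\<dots> \<le> runner_up R p U j s" using assms s' by (intro runner_up_ge)
  finally show ?thesis by simp
qed

text \<open>On clearing the positive denominator of an entry value, the terms with
  \<open>R k j\<close> cancel because \<open>s * s = 1\<close>. The winning event is thus a
  comparison of \<open>s * U j\<close> with a quantity that depends on the residuals only.\<close>

lemma runner_up_less_iff:
  assumes "2 \<le> p" "j < p" "\<And>k. k < p \<Longrightarrow> k \<noteq> j \<Longrightarrow> \<bar>R k j\<bar> < 1" "s \<in> {1, - 1}"
  shows "runner_up R p U j s < s * U j \<longleftrightarrow> (\<forall>k<p. k \<noteq> j \<longrightarrow> \<bar>U k\<bar> < s * U j)"
proof -
  have ne: "({..<p} - {j}) \<times> {1, - 1 :: real} \<noteq> {}"
  proof -
    have "(if j = 0 then 1 else 0) \<in> {..<p} - {j}" using assms by auto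
    then show ?thesis by blast
  qed
  have "entry_value R U j s (k, s') < s * U j \<longleftrightarrow> s' * U k < s * U j"
    if "k < p" "k \<noteq> j" "s' \<in> {1, - 1}" for k s'
  proof -
    have ss: "s * s = 1" using assms(4) by auto
    have "entry_value R U j s (k, s') < s * U j \<longleftrightarrow>
      s' * (U k - R k j * U j) < s * U j * (1 - s * s' * R k j)"
      using sign_mult_bound(1)[OF assms(3)[OF that(1,2)] assms(4) that(3)]
      by (simp add: entry_value_def pos_divide_less_eq)
    also have "s * U j * (1 - s * s' * R k j) = s * U j - (s * s) * (s' * (R k j * U j))"
      by (simp add: algebra_simps)
    finally show ?thesis by (simp add: ss algebra_simps)
  qed
  then have "runner_up R p U j s < s * U j \<longleftrightarrow>
      (\<forall>k<p. k \<noteq> j \<longrightarrow> (\<forall>s'\<in>{1, - 1}. s' * U k < s * U j))"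
    unfolding runner_up_def using ne by (subst Max_less_iff) auto
  also have "\<dots> \<longleftrightarrow> (\<forall>k<p. k \<noteq> j \<longrightarrow> \<bar>U k\<bar> < s * U j)" by (auto simp: abs_less_iff)
  finally show ?thesis .
qed

lemma runner_up_nonneg:
  assumes "2 \<le> p" "j < p" "\<And>k. k < p \<Longrightarrow> k \<noteq> j \<Longrightarrow> \<bar>R k j\<bar> < 1" "s \<in> {1, - 1}"
  shows "0 \<le> runner_up R p U j s"
proof -
  obtain k where "k < p" "k \<noteq> j"
    using assms(1) by (metis One_nat_def Suc_1 Suc_le_lessD less_le_trans zero_less_Suc n_not_Suc_n)
  from abs_residual_le_runner_up[of k p j R s U, OF this assms(3)[OF this] assms(4)] show ?thesis
    by linarith
qed

section \<open>Small ball probabilities\<close>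

lemma measure_normal_pos:
  assumes "0 < \<sigma>" "A \<in> sets borel" "emeasure lborel A \<noteq> 0"
  shows "0 < measure (normal_measure \<sigma>) A"
proof -
  interpret N: prob_space "normal_measure \<sigma>" using assms by (intro prob_space_normal_measure)
  have "emeasure (normal_measure \<sigma>) A \<noteq> 0"
  proof
    assume "emeasure (normal_measure \<sigma>) A = 0"
    then have "(\<integral>\<^sup>+x. ennreal (normal_density 0 \<sigma> x) * indicator A x \<partial>lborel) = 0"
      using assms by (subst (asm) emeasure_density) auto
    then have "AE x in lborel. ennreal (normal_density 0 \<sigma> x) * indicator A x = 0"
      using assms by (subst (asm) nn_integral_0_iff_AE) auto
    then have "AE x in lborel. x \<notin> A"
    proof eventually_elim
      case (elim x)
      then show ?case using normal_density_pos[OF assms(1), of 0 x]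
        by (auto simp: indicator_def split: if_splits)
    qed
    then have "emeasure lborel A = 0"
      using assms by (subst (asm) AE_iff_measurable[where N=A]) auto
    then show False using assms by simp
  qed
  then show ?thesis by (simp add: N.emeasure_eq_measure zero_less_measure_iff)
qed

lemma upper_tail_pos:
  assumes "0 < \<sigma>" shows "0 < upper_tail \<sigma> x"
proof -
  interpret N: prob_space "normal_measure \<sigma>" using assms by (intro prob_space_normal_measure)
  have "0 < N.prob {x<..x + 1}" using assms by (intro measure_normal_pos) auto
  also have "\<dots> \<le> N.prob {x<..}" by (intro N.finite_measure_mono) auto
  finally show ?thesis by (simp add: upper_tail_def)
qed

lemma measure_normal_lessThan: "measure (normal_measure \<sigma>) {..<- x} = upper_tail \<sigma> x"
proof -
  have "emeasure (normal_measure \<sigma>) {..<- x} = (\<integral>\<^sup>+z. indicator {..<- x} z \<partial>normal_measure \<sigma>)"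
    by simp
  also have "\<dots> = (\<integral>\<^sup>+z. indicator {..<- x} (- z) \<partial>normal_measure \<sigma>)"
    by (rule nn_integral_normal_measure_uminus[symmetric]) simp
  also have "\<dots> = (\<integral>\<^sup>+z. indicator {x<..} z \<partial>normal_measure \<sigma>)"
    by (intro nn_integral_cong) (auto simp: indicator_def)
  finally show ?thesis by (simp add: upper_tail_def measure_def)
qed

text \<open>The bound is uniform in the centre: if \<open>\<mu>\<close> is nonnegative, every
  \<open>z\<close> above \<open>b / \<delta>\<close> leaves the interval to the right, and otherwise
  every \<open>z\<close> below \<open>- (b / \<delta>)\<close> leaves it to the left.\<close>

lemma measure_normal_affine_ball_le:
  assumes "0 < \<sigma>" "0 < \<delta>" "\<delta> \<le> r" "0 \<le> b"
  shows "measure (normal_measure \<sigma>) {z. \<bar>\<mu> + r * z\<bar> \<le> b} \<le> 1 - upper_tail \<sigma> (b / \<delta>)"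
proof -
  interpret N: prob_space "normal_measure \<sigma>" using assms by (intro prob_space_normal_measure)
  have rz: "b < r * z" if "b / \<delta> < z" for z
  proof -
    have z: "0 < z" using that assms by (meson divide_nonneg_pos le_less_trans)
    have "b < \<delta> * z" using that assms by (simp add: pos_divide_less_eq mult.commute)
    also have "\<dots> \<le> r * z" using assms z by (intro mult_right_mono) auto
    finally show ?thesis .
  qed
  show ?thesis
  proof (cases "\<mu> \<ge> 0")
    case True
    have "N.prob {z. \<bar>\<mu> + r * z\<bar> \<le> b} \<le> N.prob (space (normal_measure \<sigma>) - {b / \<delta><..})"
      by (intro N.finite_measure_mono) (use True rz in \<open>fastforce simp: not_less[symmetric]\<close>, simp)
    also have "\<dots> = 1 - upper_tail \<sigma> (b / \<delta>)"
      unfolding upper_tail_def by (rule N.prob_compl) simp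
    finally show ?thesis .
  next
    case False
    have "N.prob {z. \<bar>\<mu> + r * z\<bar> \<le> b} \<le> N.prob (space (normal_measure \<sigma>) - {..<- (b / \<delta>)})"
    proof (intro N.finite_measure_mono)
      show "{z. \<bar>\<mu> + r * z\<bar> \<le> b} \<subseteq> space (normal_measure \<sigma>) - {..<- (b / \<delta>)}"
      proof clarsimp
        fix z assume z: "\<bar>\<mu> + r * z\<bar> \<le> b" "z < - (b / \<delta>)"
        then have "b < r * (- z)" by (intro rz) simp
        then show False using z(1) False by simp
      qed
    qed simp
    also have "\<dots> = 1 - upper_tail \<sigma> (b / \<delta>)"
      unfolding measure_normal_lessThan[symmetric] by (rule N.prob_compl) simp
    finally show ?thesis .
  qed
qed

text \<open>Induction on \<open>S\<close>. The direction \<open>e\<close> belonging to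
  \<open>i\<close> is orthogonal to all other columns in the set, so resampling along it moves only
  the coordinate of \<open>i\<close>, with slope at least \<open>\<delta>\<close>. Whatever the
  other coordinates are, this coordinate stays in the ball with probability at most the stated base,
  so each index contributes one factor.\<close>

lemma small_ball:
  assumes "0 < \<sigma>" "0 < \<delta>" "0 \<le> b" "finite S"
    and "\<And>i. i \<in> S \<Longrightarrow> \<exists>e. dot n e e = 1 \<and> (\<forall>k\<in>S - {i}. dot n (x k) e = 0) \<and> \<delta> \<le> dot n (x i) e"
  shows "measure (normal_product n \<sigma>) {y \<in> space (normal_product n \<sigma>). \<forall>k\<in>S. \<bar>dot n (x k) y\<bar> \<le> b}
    \<le> (1 - upper_tail \<sigma> (b / \<delta>)) ^ card S"
  using assms(4,5)
proof (induction S rule: finite_induct)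
  case empty
  interpret P: prob_space "normal_product n \<sigma>" using assms by (intro prob_space_normal_product)
  show ?case by simp
next
  case (insert i S)
  interpret P: prob_space "normal_product n \<sigma>" using assms by (intro prob_space_normal_product)
  interpret N: prob_space "normal_measure \<sigma>" using assms by (intro prob_space_normal_measure)
  let ?c = "1 - upper_tail \<sigma> (b / \<delta>)"
  let ?E = "{y \<in> space (normal_product n \<sigma>). \<forall>k\<in>S. \<bar>dot n (x k) y\<bar> \<le> b}"
  note [simp] = insert.hyps(1)
  obtain e where e: "dot n e e = 1" "\<forall>k\<in>S. dot n (x k) e = 0" "\<delta> \<le> dot n (x i) e"
    using insert.prems[of i] insert.hyps by auto
  have c0: "0 \<le> ?c" unfolding upper_tail_def by simp
  have "P.prob {y \<in> space (normal_product n \<sigma>). \<forall>k\<in>insert i S. \<bar>dot n (x k) y\<bar> \<le> b} =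
    (\<integral>y. N.prob {z. \<forall>k\<in>insert i S. \<bar>dot n (x k) (line_shift n e (z - dot n e y) y)\<bar> \<le> b} \<partial>normal_product n \<sigma>)"
    by (rule measure_normal_product_resample[OF assms(1) e(1)]) measurable
  also have "\<dots> \<le> (\<integral>y. ?c * indicator ?E y \<partial>normal_product n \<sigma>)"
  proof (rule integral_mono)
    show "integrable (normal_product n \<sigma>)
      (\<lambda>y. N.prob {z. \<forall>k\<in>insert i S. \<bar>dot n (x k) (line_shift n e (z - dot n e y) y)\<bar> \<le> b})"
      by (rule integrable_measure_normal[OF assms(1)]) measurable
  next
    have "?E \<in> P.events" by measurable
    then show "integrable (normal_product n \<sigma>) (\<lambda>y. ?c * indicator ?E y)"
      by (intro integrable_mult_right) (simp add: less_top[symmetric])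
  next
    fix y assume y: "y \<in> space (normal_product n \<sigma>)"
    define r where "r = dot n (x i) e"
    have *: "dot n (x i) (line_shift n e (z - dot n e y) y) = (dot n (x i) y - dot n e y * r) + r * z" for z
      unfolding dot_line_shift r_def by (simp add: algebra_simps)
    have **: "(\<forall>k\<in>S. \<bar>dot n (x k) (line_shift n e (z - dot n e y) y)\<bar> \<le> b) \<longleftrightarrow> (\<forall>k\<in>S. \<bar>dot n (x k) y\<bar> \<le> b)" for z
      using e(2) by (simp add: dot_line_shift)
    show "N.prob {z. \<forall>k\<in>insert i S. \<bar>dot n (x k) (line_shift n e (z - dot n e y) y)\<bar> \<le> b} \<le> ?c * indicator ?E y"
    proof (cases "y \<in> ?E")
      case True
      then have "N.prob {z. \<forall>k\<in>insert i S. \<bar>dot n (x k) (line_shift n e (z - dot n e y) y)\<bar> \<le> b} =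
        N.prob {z. \<bar>(dot n (x i) y - dot n e y * r) + r * z\<bar> \<le> b}"
        by (simp add: * **)
      also have "\<dots> \<le> ?c" using assms e(3) by (intro measure_normal_affine_ball_le) (auto simp: r_def)
      finally show ?thesis using True by simp
    next
      case False
      then have "{z. \<forall>k\<in>insert i S. \<bar>dot n (x k) (line_shift n e (z - dot n e y) y)\<bar> \<le> b} = {}"
        using y ** by auto
      then show ?thesis using False by (simp only: measure_empty) simp
    qed
  qed
  also have "\<dots> = ?c * P.prob ?E" by simp
  also have "\<dots> \<le> ?c * ?c ^ card S"
  proof (intro mult_left_mono insert.IH c0)
    fix i' assume "i' \<in> S"
    then show "\<exists>e. dot n e e = 1 \<and> (\<forall>k\<in>S - {i'}. dot n (x k) e = 0) \<and> \<delta> \<le> dot n (x i') e"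
      using insert.prems[of i'] by blast
  qed
  finally show ?case using insert.hyps by simp
qed

section \<open>Winning events for a Gaussian design\<close>

locale gaussian_design =
  fixes n p :: nat and \<sigma> :: real and x :: "nat \<Rightarrow> nat \<Rightarrow> real"
  assumes sigma_pos: "0 < \<sigma>" and p_ge_2: "2 \<le> p"
    and unit: "\<And>j. j < p \<Longrightarrow> dot n (x j) (x j) = 1"
    and corr: "\<And>j k. j < p \<Longrightarrow> k < p \<Longrightarrow> k \<noteq> j \<Longrightarrow> \<bar>dot n (x k) (x j)\<bar> < 1"
begin

abbreviation R :: "nat \<Rightarrow> nat \<Rightarrow> real" where "R k j \<equiv> dot n (x k) (x j)"
abbreviation U :: "(nat \<Rightarrow> real) \<Rightarrow> nat \<Rightarrow> real" where "U y k \<equiv> dot n (x k) y"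
abbreviation P :: "(nat \<Rightarrow> real) measure" where "P \<equiv> normal_product n \<sigma>"
abbreviation second :: "nat \<Rightarrow> real \<Rightarrow> (nat \<Rightarrow> real) \<Rightarrow> real" where
  "second j s y \<equiv> runner_up R p (U y) j s"
abbreviation signed_indices :: "(nat \<times> real) set" where
  "signed_indices \<equiv> {..<p} \<times> {1, - 1}"

sublocale P: prob_space P using sigma_pos by (rule prob_space_normal_product)
sublocale N: prob_space "normal_measure \<sigma>" using sigma_pos by (rule prob_space_normal_measure)

lemma measurable_second [measurable]: "second j s \<in> borel_measurable (PiM {..<n} (\<lambda>_. borel))"
  unfolding runner_up_def entry_value_def by (intro borel_measurable_Max) auto

text \<open>The residuals are orthogonal to \<open>x j\<close>. Together with resampling along
  \<open>x j\<close> this expresses their independence from \<open>U y j\<close>.\<close>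

lemma residual_line_shift:
  assumes "j < p"
  shows "U (line_shift n (x j) t y) k - R k j * U (line_shift n (x j) t y) j = U y k - R k j * U y j"
  using assms by (simp add: dot_line_shift unit algebra_simps)

text \<open>
  Restricting to \<open>|U\<^sub>j| \<le> \<sigma>\<close>, which is independent of the residuals, costs only a constant factor and
  turns a bound on the residuals into one on the \<open>U\<^sub>k\<close>, whose partial variances are controlled.
\<close>
lemma prob_second_less:
  assumes j: "j < p" "s \<in> {1, - 1}" and S: "S \<subseteq> {..<p} - {j}" and "0 \<le> m"
  shows "P.prob {y \<in> space P. second j s y < m} * N.prob {- \<sigma>..\<sigma>}
    \<le> P.prob {y \<in> space P. \<forall>k\<in>S. \<bar>U y k\<bar> \<le> 2 * m + \<sigma>}"
proof -
  have [simp]: "finite S" using S finite_subset by blast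
  let ?E = "\<lambda>y. \<forall>k\<in>S. \<bar>U y k - R k j * U y j\<bar> \<le> 2 * m"
  have "P.prob {y \<in> space P. second j s y < m} \<le> P.prob {y \<in> space P. ?E y}"
  proof (rule P.finite_measure_mono)
    show "{y \<in> space P. second j s y < m} \<subseteq> {y \<in> space P. ?E y}"
    proof safe
      fix y k assume "second j s y < m" "k \<in> S"
      moreover from this have k: "k < p" "k \<noteq> j" using S by auto
      ultimately show "\<bar>U y k - R k j * U y j\<bar> \<le> 2 * m"
        using abs_residual_le_runner_up[OF k, of R s "U y", OF corr[OF j(1) k] j(2)] by linarith
    qed
  qed measurable
  then have "P.prob {y \<in> space P. second j s y < m} * N.prob {- \<sigma>..\<sigma>} \<le>
      P.prob {y \<in> space P. ?E y} * N.prob {- \<sigma>..\<sigma>}"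
    by (intro mult_right_mono) auto
  \<comment> \<open>The product is written as an average of sections along \<open>x j\<close>. On
    each section the residuals are fixed and \<open>U y j\<close> is the fresh Gaussian, so the
    resampling identity read backwards yields the probability of the joint event.\<close>
  also have "\<dots> = (\<integral>y. indicator {y \<in> space P. ?E y} y * N.prob {- \<sigma>..\<sigma>} \<partial>P)" by simp
  also have "\<dots> = (\<integral>y. N.prob {z. ?E (line_shift n (x j) (z - U y j) y) \<and>
      \<bar>U (line_shift n (x j) (z - U y j) y) j\<bar> \<le> \<sigma>} \<partial>P)"
  proof (intro Bochner_Integration.integral_cong refl)
    fix y assume y: "y \<in> space P"
    have "U (line_shift n (x j) (z - U y j) y) j = z" for z
      using j by (simp add: dot_line_shift unit)
    moreover have "{z. \<bar>z\<bar> \<le> \<sigma>} = {- \<sigma>..\<sigma>}" by auto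
    ultimately show "indicator {y \<in> space P. ?E y} y * N.prob {- \<sigma>..\<sigma>} =
      N.prob {z. ?E (line_shift n (x j) (z - U y j) y) \<and> \<bar>U (line_shift n (x j) (z - U y j) y) j\<bar> \<le> \<sigma>}"
      unfolding residual_line_shift[OF j(1)] 
    proof (cases "?E y")
      case False
      then have "{z. ?E y \<and> \<bar>U (line_shift n (x j) (z - U y j) y) j\<bar> \<le> \<sigma>} = {}" by blast
      then show "indicator {y \<in> space P. ?E y} y * N.prob {- \<sigma>..\<sigma>} =
          N.prob {z. ?E y \<and> \<bar>U (line_shift n (x j) (z - U y j) y) j\<bar> \<le> \<sigma>}"
        using False by (simp only: measure_empty) simp
    qed (use y in simp)
  qed
  also have "\<dots> = P.prob {y \<in> space P. ?E y \<and> \<bar>U y j\<bar> \<le> \<sigma>}"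
    by (rule measure_normal_product_resample[OF sigma_pos unit[OF j(1)], symmetric]) measurable
  also have "\<dots> \<le> P.prob {y \<in> space P. \<forall>k\<in>S. \<bar>U y k\<bar> \<le> 2 * m + \<sigma>}"
  proof (rule P.finite_measure_mono)
    show "{y \<in> space P. ?E y \<and> \<bar>U y j\<bar> \<le> \<sigma>} \<subseteq> {y \<in> space P. \<forall>k\<in>S. \<bar>U y k\<bar> \<le> 2 * m + \<sigma>}"
    proof safe
      fix y k assume y: "?E y" "\<bar>U y j\<bar> \<le> \<sigma>" "k \<in> S"
      then have k: "k < p" "k \<noteq> j" using S by auto
      have "\<bar>R k j * U y j\<bar> \<le> 1 * \<sigma>"
        unfolding abs_mult using corr[OF j(1) k] y(2) sigma_pos by (intro mult_mono) auto
      moreover have "\<bar>U y k - R k j * U y j\<bar> \<le> 2 * m" using y by blast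
      ultimately show "\<bar>U y k\<bar> \<le> 2 * m + \<sigma>" by linarith
    qed
  qed measurable
  finally show ?thesis .
qed

text \<open>The threshold applies to the statistic before division by the variance; the theorem
  later inserts \<open>t * \<sigma>\<^sup>2\<close>.\<close>

definition wins :: "real \<Rightarrow> nat \<times> real \<Rightarrow> (nat \<Rightarrow> real) set" where
  "wins t = (\<lambda>(j, s). {y \<in> space P. second j s y < s * U y j \<and> t < s * U y j * (s * U y j - second j s y)})"

lemma wins_measurable [measurable]: "wins t a \<in> P.events"
  unfolding wins_def by (cases a) simp

text \<open>Resampling takes place along the signed column \<open>s * x j\<close>, so that
  \<open>s * U y j\<close> becomes exactly \<open>z\<close> while the runner-up value does not
  change. Each section is then the event measured by \<open>gap_tail\<close>.\<close>

lemma prob_wins: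
  assumes j: "j < p" "s \<in> {1, - 1}"
  shows "P.prob (wins t (j, s)) = (\<integral>y. gap_tail \<sigma> t (second j s y) \<partial>P)"
    "integrable P (\<lambda>y. gap_tail \<sigma> t (second j s y))"
proof -
  let ?e = "\<lambda>i. s * x j i"
  have ss: "s * s = 1" using j by auto
  have e: "dot n ?e ?e = 1" unfolding dot_scale unit[OF j(1)] using ss by simp
  have de: "dot n ?e y = s * U y j" for y by (simp add: dot_scale)
  have ls: "line_shift n ?e t y = line_shift n (x j) (t * s) y" for t y
    by (simp add: line_shift_def mult.assoc)
  have "entry_value R (U (line_shift n (x j) t y)) j s = entry_value R (U y) j s" for t y
    unfolding entry_value_def residual_line_shift[OF j(1)] ..
  then have sec: "second j s (line_shift n (x j) t y) = second j s y" for t y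
    by (simp add: runner_up_def)
  have proj: "s * U (line_shift n (x j) ((z - s * U y j) * s) y) j = z" for z y
    using ss j by (simp add: dot_line_shift unit algebra_simps) (metis mult.assoc mult_1)
  have "P.prob (wins t (j, s)) =
    (\<integral>y. N.prob {z. second j s (line_shift n ?e (z - dot n ?e y) y) < s * U (line_shift n ?e (z - dot n ?e y) y) j \<and>
      t < s * U (line_shift n ?e (z - dot n ?e y) y) j * (s * U (line_shift n ?e (z - dot n ?e y) y) j
         - second j s (line_shift n ?e (z - dot n ?e y) y))} \<partial>P)"
    unfolding wins_def prod.case
    by (rule measure_normal_product_resample[OF sigma_pos e]) measurable
  then show "P.prob (wins t (j, s)) = (\<integral>y. gap_tail \<sigma> t (second j s y) \<partial>P)"
    unfolding de ls sec proj gap_tail_def .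
  show "integrable P (\<lambda>y. gap_tail \<sigma> t (second j s y))"
    unfolding gap_tail_def by (rule integrable_measure_normal[OF sigma_pos]) measurable
qed

lemma second_less_iff:
  assumes "j < p" "s \<in> {1, - 1}"
  shows "second j s y < s * U y j \<longleftrightarrow> (\<forall>k<p. k \<noteq> j \<longrightarrow> \<bar>U y k\<bar> < s * U y j)"
  using p_ge_2 assms(1) corr[OF assms(1)] assms(2) by (rule runner_up_less_iff)

lemma second_nonneg:
  assumes "j < p" "s \<in> {1, - 1}"
  shows "0 \<le> second j s y"
  using p_ge_2 assms(1) corr[OF assms(1)] assms(2) by (rule runner_up_nonneg)

lemma winner_unique:
  assumes "j < p" "s \<in> {1, - 1}" "second j s y < s * U y j"
    and "j' < p" "s' \<in> {1, - 1}" "second j' s' y < s' * U y j'"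
  shows "j = j' \<and> s = s'"
proof (rule ccontr)
  assume *: "\<not> (j = j' \<and> s = s')"
  have pos: "0 < s * U y j" "0 < s' * U y j'"
    using assms second_nonneg[of j s y] second_nonneg[of j' s' y] by auto
  show False
  proof (cases "j = j'")
    case True
    then show False using * pos assms by auto
  next
    case False
    have "\<bar>U y j'\<bar> < s * U y j" "\<bar>U y j\<bar> < s' * U y j'"
      using assms False second_less_iff by blast+
    then show False using assms by auto
  qed
qed

lemma disjoint_wins: "disjoint_family_on (wins t) signed_indices"
proof (unfold disjoint_family_on_def, intro ballI impI)
  fix a b assume ab: "a \<in> signed_indices" "b \<in> signed_indices" "a \<noteq> b"
  show "wins t a \<inter> wins t b = {}"
  proof (rule equals0I)
    fix y assume "y \<in> wins t a \<inter> wins t b"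
    then show False
      using ab winner_unique[of "fst a" "snd a" y "fst b" "snd b"]
      by (auto simp: wins_def split_beta' prod_eq_iff)
  qed
qed

lemma prob_wins_Union:
  "P.prob (\<Union>(wins t ` signed_indices)) = (\<Sum>(j, s)\<in>signed_indices. \<integral>y. gap_tail \<sigma> t (second j s y) \<partial>P)"
proof -
  have "P.prob (\<Union>(wins t ` signed_indices)) = (\<Sum>a\<in>signed_indices. P.prob (wins t a))"
    by (rule P.finite_measure_finite_Union) (auto intro: disjoint_wins)
  also have "\<dots> = (\<Sum>(j, s)\<in>signed_indices. \<integral>y. gap_tail \<sigma> t (second j s y) \<partial>P)"
    by (intro sum.cong refl) (auto simp: prob_wins)
  finally show ?thesis .
qed

section \<open>Ties have probability zero\<close>

text \<open>A tie means that the linear form of \<open>x k - c * x j\<close> vanishes for a sign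
  \<open>c\<close>. The squared length of this vector is \<open>2 - 2 * c * R k j\<close>, which is
  positive.\<close>

lemma AE_abs_distinct: "AE y in P. \<forall>j<p. \<forall>k<p. k \<noteq> j \<longrightarrow> \<bar>U y k\<bar> \<noteq> \<bar>U y j\<bar>"
proof -
  have "AE y in P. U y k \<noteq> c * U y j" if "j < p" "k < p" "k \<noteq> j" "c \<in> {1, - 1}" for j k and c :: real
  proof -
    have "AE y in P. dot n (\<lambda>i. x k i - c * x j i) y \<noteq> 0"
      using that corr[of j k] unit
      by (intro AE_normal_product_dot_nonzero sigma_pos) (auto simp: dot_comb)
    then show ?thesis
      by (simp add: dot_def algebra_simps sum_subtractf sum_distrib_left)
  qed
  then have "AE y in P. \<forall>j\<in>{..<p}. \<forall>k\<in>{..<p}. \<forall>c\<in>{1, - 1}. k \<noteq> j \<longrightarrow> U y k \<noteq> c * U y j"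
    by (intro AE_finite_allI) (auto intro!: AE_finite_allI)
  then show ?thesis
    by eventually_elim (auto simp: abs_eq_iff)
qed

text \<open>The difference of two entry values is a linear form in \<open>y\<close> with coefficient
  vector \<open>a\<close>, so it suffices that \<open>a\<close> has nonzero length. The case
  \<open>k = l\<close> with opposite signs is included; it will show that the runner-up value is not
  0.\<close>

lemma AE_entry_values_distinct:
  "AE y in P. \<forall>j<p. \<forall>s\<in>{1, - 1}. inj_on (entry_value R (U y) j s) (({..<p} - {j}) \<times> {1, - 1})"
proof -
  have distinct: "AE y in P. entry_value R (U y) j s (k, s') \<noteq> entry_value R (U y) j s (l, s'')"
    if j: "j < p" "s \<in> {1, - 1}" and k: "k < p" "k \<noteq> j" "s' \<in> {1, - 1}"
      and l: "l < p" "l \<noteq> j" "s'' \<in> {1, - 1}" and ne: "(k, s') \<noteq> (l, s'')" for j k l and s s' s'' :: real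
  proof -
    define b c where "b = 1 - s * s' * R k j" and "c = 1 - s * s'' * R l j"
    have pos: "0 < b" "0 < c"
      using sign_mult_bound(1)[OF corr[OF j(1) k(1,2)] j(2) k(3)]
        sign_mult_bound(1)[OF corr[OF j(1) l(1,2)] j(2) l(3)] by (simp_all add: b_def c_def)
    define u v where "u = s' / b" and "v = s'' / c"
    define a where "a i = u * (x k i - R k j * x j i) - v * (x l i - R l j * x j i)" for i
    have dot_a: "dot n a w = u * (U w k - R k j * U w j) - v * (U w l - R l j * U w j)" for w
      unfolding a_def dot_def
      by (simp only: sum_subtractf sum_distrib_left left_diff_distrib right_diff_distrib mult.assoc)
    have "dot n a a = u * (dot n a (x k) - R k j * dot n a (x j)) - v * (dot n a (x l) - R l j * dot n a (x j))"
      using dot_a[of a] by (simp add: dot_commute)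
    also have "\<dots> = u\<^sup>2 * (1 - (R k j)\<^sup>2) + v\<^sup>2 * (1 - (R l j)\<^sup>2)
        - 2 * u * v * (R k l - R k j * R l j)"
      unfolding dot_a unit[OF j(1)] unit[OF k(1)] unit[OF l(1)]
        dot_commute[of n "x l" "x k"] dot_commute[of n "x j" "x k"] dot_commute[of n "x j" "x l"]
      by (simp add: power2_eq_square algebra_simps)
    finally have dot_aa: "dot n a a = u\<^sup>2 * (1 - (R k j)\<^sup>2) + v\<^sup>2 * (1 - (R l j)\<^sup>2)
        - 2 * u * v * (R k l - R k j * R l j)" .
    have "s' = u * b" "s'' = v * c" using pos by (simp_all add: u_def v_def)
    then have "(b * c)\<^sup>2 * dot n a a = (s' * c)\<^sup>2 * (1 - (R k j)\<^sup>2) + (s'' * b)\<^sup>2 * (1 - (R l j)\<^sup>2)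
        - 2 * (s' * c) * (s'' * b) * (R k l - R k j * R l j)"
      unfolding dot_aa by (simp add: algebra_simps power2_eq_square)
    \<comment> \<open>This identity is the non-collinearity of the three unit vectors \<open>s X\<^sub>j\<close>, \<open>s' X\<^sub>k\<close>, \<open>s'' X\<^sub>l\<close>.\<close>
    also have "\<dots> = 2 * b * c * (1 - s' * s'' * R k l)"
      using j(2) k(3) l(3) unfolding b_def c_def by (auto simp: power2_eq_square algebra_simps)
    also have "\<dots> > 0"
    proof -
      have "0 < 1 - s' * s'' * R k l"
      proof (cases "k = l")
        case True
        then show ?thesis using ne k l by (auto simp: unit)
      next
        case False
        then show ?thesis using sign_mult_bound(1)[OF corr[OF l(1) k(1)] k(3) l(3)] by simp
      qed
      then show ?thesis using pos by simp
    qed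
    finally have "dot n a a \<noteq> 0" by auto
    from AE_normal_product_dot_nonzero[OF sigma_pos this] show ?thesis
    proof eventually_elim
      case (elim y)
      then show ?case by (simp add: dot_a u_def v_def entry_value_def b_def[symmetric] c_def[symmetric])
    qed
  qed
  have "AE y in P. \<forall>j\<in>{..<p}. \<forall>s\<in>{1, - 1}. \<forall>a\<in>({..<p} - {j}) \<times> {1, - 1}. \<forall>b\<in>({..<p} - {j}) \<times> {1, - 1}.
      a \<noteq> b \<longrightarrow> entry_value R (U y) j s a \<noteq> entry_value R (U y) j s b"
  proof (intro AE_finite_allI AE_impI)
    fix j s a b assume *: "j \<in> {..<p}" "s \<in> {1, - 1 :: real}" "a \<in> ({..<p} - {j}) \<times> {1, - 1 :: real}"
      "b \<in> ({..<p} - {j}) \<times> {1, - 1 :: real}" "a \<noteq> b"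
    obtain k s' l s'' where ab: "a = (k, s')" "b = (l, s'')" by (cases a, cases b)
    show "AE y in P. entry_value R (U y) j s a \<noteq> entry_value R (U y) j s b"
      unfolding ab by (rule distinct) (use * ab in auto)
  qed auto
  then show ?thesis
  proof eventually_elim
    case (elim y)
    then show ?case unfolding inj_on_def by blast
  qed
qed

lemma winner_exists:
  assumes "\<forall>j<p. \<forall>k<p. k \<noteq> j \<longrightarrow> \<bar>U y k\<bar> \<noteq> \<bar>U y j\<bar>"
  shows "\<exists>j<p. \<exists>s\<in>{1, - 1}. second j s y < s * U y j"
proof -
  have "finite ((\<lambda>k. \<bar>U y k\<bar>) ` {..<p})" "(\<lambda>k. \<bar>U y k\<bar>) ` {..<p} \<noteq> {}"
    using p_ge_2 by (auto simp: lessThan_empty_iff)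
  from Max_in[OF this] obtain j where j: "j < p" "\<bar>U y j\<bar> = Max ((\<lambda>k. \<bar>U y k\<bar>) ` {..<p})" by auto
  have lt: "\<bar>U y k\<bar> < \<bar>U y j\<bar>" if "k < p" "k \<noteq> j" for k
  proof -
    have "\<bar>U y k\<bar> \<le> \<bar>U y j\<bar>" unfolding j(2) using that by (intro Max_ge) auto
    moreover have "\<bar>U y k\<bar> \<noteq> \<bar>U y j\<bar>" using assms that j(1) by blast
    ultimately show ?thesis by simp
  qed
  define s :: real where "s = (if U y j \<ge> 0 then 1 else - 1)"
  have s: "s \<in> {1, - 1}" "s * U y j = \<bar>U y j\<bar>" by (auto simp: s_def)
  show ?thesis
  proof (intro exI[of _ j] bexI[of _ s] conjI)
    show "second j s y < s * U y j" using lt s(2) second_less_iff[OF j(1) s(1), of y] by simp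
  qed (use j s in auto)
qed

section \<open>Summation over the signed indices\<close>

text \<open>Without ties some signed index wins, and with a positive gap. This normalisation turns
  relative errors for the single indices into an absolute error for their sum.\<close>

lemma prob_wins_0: "P.prob (\<Union>(wins 0 ` signed_indices)) = 1"
proof (subst P.prob_eq_1)
  show "AE y in P. y \<in> \<Union>(wins 0 ` signed_indices)"
    using AE_abs_distinct AE_space
  proof eventually_elim
    case (elim y)
    from winner_exists[OF elim(1)] obtain j s where js: "j < p" "s \<in> {1, - 1}" "second j s y < s * U y j" by blast
    then have "0 < s * U y j * (s * U y j - second j s y)"
      using second_nonneg[OF js(1,2), of y]
      by (intro mult_pos_pos[of "s * U y j" "s * U y j - second j s y"]) linarith+
    then have "y \<in> wins 0 (j, s)" using js elim by (simp add: wins_def)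
    then show ?case using js by blast
  qed
qed (auto intro!: sets.finite_UN)

lemma gap_tail_01: "0 \<le> gap_tail \<sigma> t m" "gap_tail \<sigma> t m \<le> 1"
  by (simp_all add: gap_tail_def)

text \<open>Where the runner-up value is at least \<open>m0\<close> the relative error bound
  applies; elsewhere the integrand differs by at most 1, which costs the probability of that event.
  The winning probabilities at threshold 0 sum to 1, so the relative errors add up to
  \<open>\<epsilon>\<close>.\<close>

lemma prob_wins_approx:
  assumes "0 \<le> t" "0 < \<epsilon>"
    and m0: "\<And>m. m0 \<le> m \<Longrightarrow> \<bar>gap_tail \<sigma> (t * \<sigma>\<^sup>2) m - exp (- t) * gap_tail \<sigma> 0 m\<bar> \<le> \<epsilon> * gap_tail \<sigma> 0 m"
  shows "\<bar>P.prob (\<Union>(wins (t * \<sigma>\<^sup>2) ` signed_indices)) - exp (- t)\<bar>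
    \<le> \<epsilon> + (\<Sum>(j, s)\<in>signed_indices. P.prob {y \<in> space P. second j s y < m0})"
proof -
  let ?g = "\<lambda>t j s y. gap_tail \<sigma> t (second j s y)"
  let ?E = "\<lambda>j s. {y \<in> space P. second j s y < m0}"
  have one: "(\<Sum>(j, s)\<in>signed_indices. \<integral>y. ?g 0 j s y \<partial>P) = 1"
    using prob_wins_Union[of 0] prob_wins_0 by simp
  have bound: "\<bar>(\<integral>y. ?g (t * \<sigma>\<^sup>2) j s y \<partial>P) - exp (- t) * (\<integral>y. ?g 0 j s y \<partial>P)\<bar> \<le>
      \<epsilon> * (\<integral>y. ?g 0 j s y \<partial>P) + P.prob (?E j s)" if "j < p" "s \<in> {1, - 1}" for j s
  proof -
    note int = prob_wins(2)[OF that]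
    have intE: "integrable P (indicator (?E j s) :: _ \<Rightarrow> real)"
      by (intro integrable_real_indicator) (auto simp: less_top[symmetric])
    have "\<bar>(\<integral>y. ?g (t * \<sigma>\<^sup>2) j s y \<partial>P) - exp (- t) * (\<integral>y. ?g 0 j s y \<partial>P)\<bar> =
      \<bar>\<integral>y. ?g (t * \<sigma>\<^sup>2) j s y - exp (- t) * ?g 0 j s y \<partial>P\<bar>"
      using int by simp
    also have "\<dots> \<le> (\<integral>y. \<bar>?g (t * \<sigma>\<^sup>2) j s y - exp (- t) * ?g 0 j s y\<bar> \<partial>P)"
      by (rule integral_abs_bound)
    also have "\<dots> \<le> (\<integral>y. \<epsilon> * ?g 0 j s y + indicator (?E j s) y \<partial>P)"
    proof (rule integral_mono)
      fix y assume y: "y \<in> space P"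
      show "\<bar>?g (t * \<sigma>\<^sup>2) j s y - exp (- t) * ?g 0 j s y\<bar> \<le> \<epsilon> * ?g 0 j s y + indicator (?E j s) y"
      proof (cases "second j s y < m0")
        case True
        have "0 \<le> exp (- t) * ?g 0 j s y" "exp (- t) * ?g 0 j s y \<le> 1"
          using assms gap_tail_01[of 0 "second j s y"] by (auto intro!: mult_le_one)
        then have "\<bar>?g (t * \<sigma>\<^sup>2) j s y - exp (- t) * ?g 0 j s y\<bar> \<le> 1"
          using gap_tail_01[of "t * \<sigma>\<^sup>2" "second j s y"] by (simp add: abs_le_iff)
        moreover have "0 \<le> \<epsilon> * ?g 0 j s y" using assms gap_tail_01[of 0 "second j s y"] by simp
        ultimately show ?thesis using True y by simp
      next
        case False
        then show ?thesis using m0[of "second j s y"] by simp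
      qed
    qed (use int intE in auto)
    also have "\<dots> = \<epsilon> * (\<integral>y. ?g 0 j s y \<partial>P) + P.prob (?E j s)"
      using int intE by simp
    finally show ?thesis .
  qed
  have "\<bar>P.prob (\<Union>(wins (t * \<sigma>\<^sup>2) ` signed_indices)) - exp (- t)\<bar> =
    \<bar>(\<Sum>(j, s)\<in>signed_indices. (\<integral>y. ?g (t * \<sigma>\<^sup>2) j s y \<partial>P) - exp (- t) * (\<integral>y. ?g 0 j s y \<partial>P))\<bar>"
    using one unfolding prob_wins_Union
    by (simp add: sum_subtractf sum_distrib_left[symmetric] split_beta')
  also have "\<dots> \<le> (\<Sum>(j, s)\<in>signed_indices. \<bar>(\<integral>y. ?g (t * \<sigma>\<^sup>2) j s y \<partial>P) - exp (- t) * (\<integral>y. ?g 0 j s y \<partial>P)\<bar>)"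
    unfolding split_beta' by (rule sum_abs)
  also have "\<dots> \<le> (\<Sum>(j, s)\<in>signed_indices. \<epsilon> * (\<integral>y. ?g 0 j s y \<partial>P) + P.prob (?E j s))"
    by (intro sum_mono) (use bound in auto)
  also have "\<dots> = \<epsilon> * (\<Sum>(j, s)\<in>signed_indices. \<integral>y. ?g 0 j s y \<partial>P) + (\<Sum>(j, s)\<in>signed_indices. P.prob (?E j s))"
    by (simp add: sum.distrib sum_distrib_left split_beta')
  finally show ?thesis unfolding one by simp
qed

end

section \<open>The first step of the lasso path\<close>

lemma l2_norm_square: "(l2_norm v)\<^sup>2 = v \<bullet> v"
  unfolding l2_norm_def by (simp add: scalar_prod_def sum_nonneg)

lemma mult_mat_vec_scalar_prod:
  fixes X :: "real mat"
  assumes "X \<in> carrier_mat n p" "b \<in> carrier_vec p" "w \<in> carrier_vec n"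
  shows "(X *\<^sub>v b) \<bullet> w = (\<Sum>k<p. b $ k * (col X k \<bullet> w))"
proof -
  have "(X *\<^sub>v b) \<bullet> w = (\<Sum>i<n. (\<Sum>k<p. X $$ (i, k) * b $ k) * w $ i)"
    using assms by (simp add: scalar_prod_def lessThan_atLeast0)
  also have "\<dots> = (\<Sum>i<n. \<Sum>k<p. b $ k * (X $$ (i, k) * w $ i))"
    unfolding sum_distrib_right by (intro sum.cong refl) (simp add: algebra_simps)
  also have "\<dots> = (\<Sum>k<p. \<Sum>i<n. b $ k * (X $$ (i, k) * w $ i))" by (rule sum.swap)
  also have "\<dots> = (\<Sum>k<p. b $ k * (col X k \<bullet> w))"
    using assms by (simp add: scalar_prod_def lessThan_atLeast0 sum_distrib_left)
  finally show ?thesis .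
qed

text \<open>Expand the square around \<open>b\<close>. By complementary slackness the linear term
  \<open>w \<bullet> r\<close> contributes \<open>l\<close> times the l1 norm of \<open>b\<close>,
  which cancels against the penalty, so the expansion is exact.\<close>

lemma lasso_objective_diff:
  assumes X: "X \<in> carrier_mat n p" and y: "y \<in> carrier_vec n"
    and b: "b \<in> carrier_vec p" "b' \<in> carrier_vec p"
    and g: "\<And>k. k < p \<Longrightarrow> g k = col X k \<bullet> (y - X *\<^sub>v b)"
    and kkt: "\<And>k. k < p \<Longrightarrow> g k * b $ k = l * \<bar>b $ k\<bar>"
  shows "lasso_objective X y l b' - lasso_objective X y l b =
    1/2 * ((X *\<^sub>v (b' - b)) \<bullet> (X *\<^sub>v (b' - b))) + (\<Sum>k<p. l * \<bar>b' $ k\<bar> - g k * b' $ k)"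
proof -
  define r w where "r = y - X *\<^sub>v b" and "w = X *\<^sub>v (b' - b)"
  have c: "r \<in> carrier_vec n" "w \<in> carrier_vec n" using X y b by (auto simp: r_def w_def)
  have "X *\<^sub>v b' = X *\<^sub>v b + w"
  proof -
    have "b' = b + (b' - b)" using b by auto
    then have "X *\<^sub>v b' = X *\<^sub>v (b + (b' - b))" by simp
    also have "\<dots> = X *\<^sub>v b + w" unfolding w_def using X b by (intro mult_add_distrib_mat_vec) auto
    finally show ?thesis .
  qed
  then have "y - X *\<^sub>v b' = r - w" using X y b c by (auto simp: r_def)
  then have "(y - X *\<^sub>v b') \<bullet> (y - X *\<^sub>v b') = r \<bullet> r - 2 * (w \<bullet> r) + w \<bullet> w"
    using c by (simp add: minus_scalar_prod_distrib scalar_prod_minus_distrib comm_scalar_prod[of r n w])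
  moreover have "w \<bullet> r = (\<Sum>k<p. g k * b' $ k) - (\<Sum>k<p. l * \<bar>b $ k\<bar>)"
  proof -
    have "w \<bullet> r = (\<Sum>k<p. (b' - b) $ k * (col X k \<bullet> r))"
      unfolding w_def using X b c by (intro mult_mat_vec_scalar_prod) auto
    also have "\<dots> = (\<Sum>k<p. g k * b' $ k - g k * b $ k)"
      using b g by (intro sum.cong) (auto simp: r_def algebra_simps)
    also have "\<dots> = (\<Sum>k<p. g k * b' $ k) - (\<Sum>k<p. l * \<bar>b $ k\<bar>)"
      using kkt by (simp add: sum_subtractf)
    finally show ?thesis .
  qed
  moreover have "l * l1_norm v = (\<Sum>k<p. l * \<bar>v $ k\<bar>)" if "v \<in> carrier_vec p" for v
    using that by (simp add: l1_norm_def sum_distrib_left)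
  ultimately show ?thesis
    unfolding lasso_objective_def l2_norm_square w_def[symmetric] r_def[symmetric] sum_subtractf
    using b by (simp add: field_simps)
qed

text \<open>Both parts of the expansion are nonnegative, so \<open>b\<close> is a minimiser. For any
  other minimiser both parts vanish: the strict inequalities force its coordinates outside
  \<open>E\<close> to be 0, and injectivity of \<open>X\<close> on vectors supported in
  \<open>E\<close> removes the difference to \<open>b\<close>.\<close>

lemma lasso_eqI:
  assumes X: "X \<in> carrier_mat n p" and y: "y \<in> carrier_vec n" and b: "b \<in> carrier_vec p"
    and g: "\<And>k. k < p \<Longrightarrow> g k = col X k \<bullet> (y - X *\<^sub>v b)"
    and kkt: "\<And>k. k < p \<Longrightarrow> \<bar>g k\<bar> \<le> l" "\<And>k. k < p \<Longrightarrow> g k * b $ k = l * \<bar>b $ k\<bar>"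
    and strict: "\<And>k. k < p \<Longrightarrow> k \<notin> E \<Longrightarrow> b $ k = 0 \<and> \<bar>g k\<bar> < l"
    and inj: "\<And>v. v \<in> carrier_vec p \<Longrightarrow> (\<And>k. k < p \<Longrightarrow> k \<notin> E \<Longrightarrow> v $ k = 0) \<Longrightarrow>
      (X *\<^sub>v v) \<bullet> (X *\<^sub>v v) = 0 \<Longrightarrow> v = 0\<^sub>v p"
  shows "lasso X y l = b"
proof -
  have diff: "lasso_objective X y l b' - lasso_objective X y l b =
    1/2 * ((X *\<^sub>v (b' - b)) \<bullet> (X *\<^sub>v (b' - b))) + (\<Sum>k<p. l * \<bar>b' $ k\<bar> - g k * b' $ k)"
    if "b' \<in> carrier_vec p" for b'
    using lasso_objective_diff[OF X y b that g kkt(2)] .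
  have term_nonneg: "0 \<le> l * \<bar>c\<bar> - g k * c" if "k < p" for k c
  proof -
    have "g k * c \<le> \<bar>g k\<bar> * \<bar>c\<bar>" by (simp add: abs_mult[symmetric])
    also have "\<dots> \<le> l * \<bar>c\<bar>" using kkt(1)[OF that] by (intro mult_right_mono) auto
    finally show ?thesis by simp
  qed
  have sq: "0 \<le> w \<bullet> w" for w :: "real vec" by (simp add: scalar_prod_def sum_nonneg)
  have sum0: "0 \<le> (\<Sum>k<p. l * \<bar>b' $ k\<bar> - g k * b' $ k)" for b' using term_nonneg by (intro sum_nonneg) auto
  have le: "lasso_objective X y l b \<le> lasso_objective X y l b'" if "b' \<in> carrier_vec p" for b'
    using diff[OF that] sq[of "X *\<^sub>v (b' - b)"] sum0[of b'] by linarith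
  have "b' = b" if b': "is_arg_min (lasso_objective X y l) (\<lambda>b. b \<in> carrier_vec p) b'" for b'
  proof -
    have c: "b' \<in> carrier_vec p" using b' by (simp add: is_arg_min_def)
    have "lasso_objective X y l b' \<le> lasso_objective X y l b"
      using b' b by (auto simp: is_arg_min_def not_less)
    with diff[OF c] sq[of "X *\<^sub>v (b' - b)"] sum0[of b']
    have z: "(X *\<^sub>v (b' - b)) \<bullet> (X *\<^sub>v (b' - b)) = 0" "(\<Sum>k<p. l * \<bar>b' $ k\<bar> - g k * b' $ k) = 0"
      by linarith+
    have "b' - b = 0\<^sub>v p"
    proof (rule inj[OF _ _ z(1)])
      fix k assume k: "k < p" "k \<notin> E"
      have "l * \<bar>b' $ k\<bar> - g k * b' $ k = 0"
        using z(2) term_nonneg k by (subst (asm) sum_nonneg_eq_0_iff) auto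
      then have "l * \<bar>b' $ k\<bar> = g k * b' $ k" by simp
      also have "\<dots> \<le> \<bar>g k\<bar> * \<bar>b' $ k\<bar>" by (simp add: abs_mult[symmetric])
      finally have "(l - \<bar>g k\<bar>) * \<bar>b' $ k\<bar> \<le> 0" by (simp add: algebra_simps)
      then have "b' $ k = 0" using strict[OF k] by (simp add: mult_le_0_iff)
      then show "(b' - b) $ k = 0" using strict[OF k] k b c by simp
    qed (use b c in auto)
    show ?thesis
    proof (rule eq_vecI)
      fix k assume "k < dim_vec b"
      then have "b' $ k - b $ k = (b' - b) $ k" "k < p" using b by auto
      then show "b' $ k = b $ k" using \<open>b' - b = 0\<^sub>v p\<close> by simp
    qed (use b c in auto)
  qed
  moreover have "is_arg_min (lasso_objective X y l) (\<lambda>b. b \<in> carrier_vec p) b"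
    using le b by (auto simp: is_arg_min_def not_less)
  ultimately show ?thesis
    unfolding lasso_def arg_min_def carrier_matD(2)[OF X] by (intro some_equality)
qed

definition two_vec :: "nat \<Rightarrow> nat \<Rightarrow> nat \<Rightarrow> real \<Rightarrow> real \<Rightarrow> real vec" where
  "two_vec p j k a b = vec p (\<lambda>i. if i = j then a else if i = k then b else 0)"

locale unit_design =
  fixes n p :: nat and X :: "real mat" and y :: "real vec"
  assumes X: "X \<in> carrier_mat n p" and y: "y \<in> carrier_vec n"
    and unit: "\<And>j. j < p \<Longrightarrow> col X j \<bullet> col X j = 1"
    and corr: "\<And>j k. j < p \<Longrightarrow> k < p \<Longrightarrow> k \<noteq> j \<Longrightarrow> \<bar>col X k \<bullet> col X j\<bar> < 1"
begin

abbreviation R :: "nat \<Rightarrow> nat \<Rightarrow> real" where "R k j \<equiv> col X k \<bullet> col X j"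
abbreviation U :: "nat \<Rightarrow> real" where "U k \<equiv> col X k \<bullet> y"

lemma col_carrier [simp]: "col X k \<in> carrier_vec n" using X by auto

lemma R_commute: "R k j = R j k" by (rule comm_scalar_prod) (rule col_carrier)+

lemma two_vec_sum:
  assumes "j < p" "k < p" "k \<noteq> j" "\<And>i. i < p \<Longrightarrow> i \<notin> {j, k} \<Longrightarrow> v $ i = 0"
  shows "(\<Sum>i<p. v $ i * f i) = v $ j * f j + v $ k * (f k :: real)"
proof -
  have "(\<Sum>i<p. v $ i * f i) = (\<Sum>i\<in>{j, k}. v $ i * f i)"
    using assms by (intro sum.mono_neutral_right) auto
  then show ?thesis using assms by simp
qed

text \<open>The optimality conditions for a solution supported in two columns. At \<open>j\<close>
  and \<open>k\<close> only weak bounds are asked, so that a coefficient may still be 0 when its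
  correlation has just reached \<open>l\<close>, as happens at the second knot.\<close>

lemma lasso_two_vec:
  assumes jk: "j < p" "k < p" "k \<noteq> j"
    and kj: "\<bar>U j - a - b * R k j\<bar> \<le> l" "(U j - a - b * R k j) * a = l * \<bar>a\<bar>"
    and kk: "\<bar>U k - a * R k j - b\<bar> \<le> l" "(U k - a * R k j - b) * b = l * \<bar>b\<bar>"
    and rest: "\<And>i. i < p \<Longrightarrow> i \<noteq> j \<Longrightarrow> i \<noteq> k \<Longrightarrow> \<bar>U i - a * R i j - b * R i k\<bar> < l"
  shows "lasso X y l = two_vec p j k a b"
proof (rule lasso_eqI[OF X y, where E="{j, k}" and g="\<lambda>i. U i - a * R i j - b * R i k"])
  let ?v = "two_vec p j k a b"
  show v: "?v \<in> carrier_vec p" by (simp add: two_vec_def)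
  have vj: "?v $ j = a" "?v $ k = b" "\<And>i. i < p \<Longrightarrow> i \<notin> {j, k} \<Longrightarrow> ?v $ i = 0"
    using jk by (auto simp: two_vec_def)
  fix i assume i: "i < p"
  have Xv: "X *\<^sub>v ?v \<in> carrier_vec n" using X v by auto
  have "col X i \<bullet> (X *\<^sub>v ?v) = (X *\<^sub>v ?v) \<bullet> col X i"
    using Xv by (intro comm_scalar_prod) auto
  also have "\<dots> = (\<Sum>m<p. ?v $ m * R m i)" using X v by (intro mult_mat_vec_scalar_prod) auto
  also have "\<dots> = a * R i j + b * R i k"
    using two_vec_sum[OF jk, of ?v "\<lambda>m. R m i"] vj R_commute[of i] by simp
  finally show "U i - a * R i j - b * R i k = col X i \<bullet> (y - X *\<^sub>v ?v)"
    using Xv y by (subst scalar_prod_minus_distrib[of _ n]) auto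
  have g: "U j - a * R j j - b * R j k = U j - a - b * R k j" "U k - a * R k j - b * R k k = U k - a * R k j - b"
    using jk by (simp_all add: unit R_commute[of j k])
  consider "i = j" | "i = k" | "i \<notin> {j, k}" by blast
  then show "\<bar>U i - a * R i j - b * R i k\<bar> \<le> l"
    by cases (use i kj(1) kk(1) rest[OF i] in \<open>simp_all only: g, auto\<close>)
  consider "i = j" | "i = k" | "i \<notin> {j, k}" by blast
  then show "(U i - a * R i j - b * R i k) * ?v $ i = l * \<bar>?v $ i\<bar>"
    by cases (use vj(3)[OF i] in \<open>simp_all only: g vj(1,2) kj(2) kk(2), simp\<close>)
  show "?v $ i = 0 \<and> \<bar>U i - a * R i j - b * R i k\<bar> < l" if "i \<notin> {j, k}"
    using that i rest vj by auto
next
  fix v assume v: "v \<in> carrier_vec p" "\<And>i. i < p \<Longrightarrow> i \<notin> {j, k} \<Longrightarrow> v $ i = 0"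
    and 0: "(X *\<^sub>v v) \<bullet> (X *\<^sub>v v) = 0"
  have Xv: "X *\<^sub>v v \<in> carrier_vec n" using X v by auto
  have d: "col X i \<bullet> (X *\<^sub>v v) = v $ j * R i j + v $ k * R i k" for i
  proof -
    have "col X i \<bullet> (X *\<^sub>v v) = (X *\<^sub>v v) \<bullet> col X i"
      using Xv by (intro comm_scalar_prod) auto
    also have "\<dots> = (\<Sum>m<p. v $ m * R m i)" using X v by (intro mult_mat_vec_scalar_prod) auto
    finally show ?thesis using two_vec_sum[OF jk v(2), of "\<lambda>m. R m i"] R_commute[of i] by simp
  qed
  have "(X *\<^sub>v v) \<bullet> (X *\<^sub>v v) = (\<Sum>m<p. v $ m * (col X m \<bullet> (X *\<^sub>v v)))"
    using X v Xv by (intro mult_mat_vec_scalar_prod) auto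
  also have "\<dots> = v $ j * (v $ j * R j j + v $ k * R j k) + v $ k * (v $ j * R k j + v $ k * R k k)"
    unfolding d by (rule two_vec_sum[OF jk v(2)])
  \<comment> \<open>Completing the square; by \<open>corr\<close> the quadratic form is positive
    definite, so the two columns are linearly independent.\<close>
  also have "\<dots> = (v $ j + R k j * v $ k)\<^sup>2 + (1 - (R k j)\<^sup>2) * (v $ k)\<^sup>2"
    using jk by (simp add: unit R_commute[of j k] power2_eq_square algebra_simps)
  finally have e: "(v $ j + R k j * v $ k)\<^sup>2 + (1 - (R k j)\<^sup>2) * (v $ k)\<^sup>2 = 0" using 0 by simp
  have "(R k j)\<^sup>2 < 1" using corr[OF jk] by (simp add: abs_square_less_1)
  then have lt: "0 < 1 - (R k j)\<^sup>2" by simp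
  then have "0 \<le> (1 - (R k j)\<^sup>2) * (v $ k)\<^sup>2" by simp
  with e zero_le_power2[of "v $ j + R k j * v $ k"]
  have "(1 - (R k j)\<^sup>2) * (v $ k)\<^sup>2 = 0" "(v $ j + R k j * v $ k)\<^sup>2 = 0" by linarith+
  then have "v $ k = 0 \<and> v $ j = 0" using lt by simp
  then show "v = 0\<^sub>v p" using v by (intro eq_vecI) auto
qed


abbreviation second :: "nat \<Rightarrow> real \<Rightarrow> real" where "second j s \<equiv> runner_up R p U j s"

end

section \<open>The path around its first two knots\<close>

text \<open>The generic configuration: \<open>j\<close> with sign \<open>s\<close> wins and a single
  pair \<open>(k, s')\<close> attains the runner-up value, so that exactly one column reaches the
  boundary at the second knot.\<close>

locale first_step = unit_design +
  fixes j k :: nat and s s' :: real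
  assumes j: "j < p" "s \<in> {1, - 1}" and k: "k < p" "k \<noteq> j" "s' \<in> {1, - 1}"
    and runner: "entry_value R U j s (k, s') = second j s"
    and strict: "\<And>i r. i < p \<Longrightarrow> i \<noteq> j \<Longrightarrow> r \<in> {1, - 1} \<Longrightarrow> (i, r) \<noteq> (k, s') \<Longrightarrow>
      entry_value R U j s (i, r) < second j s"
    and second_pos: "0 < second j s"
    and first: "second j s < s * U j"
begin

abbreviation "knot1 \<equiv> s * U j"
abbreviation "knot2 \<equiv> second j s"

lemma ss: "s * s = 1" "s' * s' = 1" "s * (s * a) = a" "s' * (s' * a) = a"
  using j k by auto

lemma U_j: "U j = s * knot1" by (simp add: ss)

text \<open>Clearing denominators, as long as \<open>l\<close> exceeds both entry values of column
  \<open>i\<close>, its correlation with the residual of the one-variable fit stays strictly inside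
  the bound.\<close>

lemma abs_residual_less:
  assumes "i < p" "i \<noteq> j" "\<And>r. r \<in> {1, - 1} \<Longrightarrow> entry_value R U j s (i, r) < l"
  shows "\<bar>U i - s * (knot1 - l) * R i j\<bar> < l"
proof -
  have "r * (U i - s * (knot1 - l) * R i j) < l" if "r \<in> {1, - 1}" for r
  proof -
    have "r * (U i - R i j * U j) < l * (1 - s * r * R i j)"
      using assms(3)[OF that] sign_mult_bound(1)[OF corr[OF j(1) assms(1,2)] j(2) that]
      by (simp add: entry_value_def pos_divide_less_eq)
    moreover have "r * (U i - s * (knot1 - l) * R i j) = r * (U i - R i j * U j) + l * (s * r * R i j)"
      by (simp add: algebra_simps ss)
    ultimately show ?thesis by (simp add: algebra_simps ss)
  qed
  from this[of 1] this[of "- 1"] show ?thesis by (simp add: abs_less_iff)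
qed

text \<open>The solution is soft thresholding in coordinate \<open>j\<close>; \<open>max 0\<close>
  joins the zero part of the path to the segment below the first knot. Column \<open>k\<close> is
  carried along with coefficient 0.\<close>

lemma lasso_before_second:
  assumes "knot2 < l"
  shows "lasso X y l = two_vec p j k (s * max 0 (knot1 - l)) 0"
proof (cases "l < knot1")
  case True
  have less: "\<bar>U i - s * (knot1 - l) * R i j\<bar> < l" if "i < p" "i \<noteq> j" for i
    using that assms runner_up_ge[OF that, of _ R U s] by (intro abs_residual_less) (auto simp del: insert_iff intro: le_less_trans)
  have g: "U j - s * (knot1 - l) = s * l" using U_j by (simp add: algebra_simps ss)
  have "lasso X y l = two_vec p j k (s * (knot1 - l)) 0"
  proof (rule lasso_two_vec[OF j(1) k(1,2)])
    show "\<bar>U j - s * (knot1 - l) - 0 * R k j\<bar> \<le> l"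
      using g j(2) assms second_pos by (auto simp: abs_mult)
    have "\<bar>s * (knot1 - l)\<bar> = knot1 - l" using j(2) True by (auto simp: abs_mult)
    then show "(U j - s * (knot1 - l) - 0 * R k j) * (s * (knot1 - l)) = l * \<bar>s * (knot1 - l)\<bar>"
      using g by (simp add: ss mult.assoc mult.left_commute)
  qed (use less k in \<open>auto simp: less_imp_le\<close>)
  then show ?thesis using True by simp
next
  case False
  have "\<bar>U i\<bar> < knot1" if "i < p" "i \<noteq> j" for i
  proof -
    have "2 \<le> p" using j k by linarith
    then show ?thesis using first runner_up_less_iff[of p j R s U] j corr that by auto
  qed
  then have less: "\<bar>U i\<bar> < l" if "i < p" "i \<noteq> j" for i using that False by force
  have "lasso X y l = two_vec p j k 0 0"
  proof (rule lasso_two_vec[OF j(1) k(1,2)])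
    have "\<bar>U j\<bar> = knot1" using first second_pos j(2) by auto
    then show "\<bar>U j - 0 - 0 * R k j\<bar> \<le> l" using False by simp
  qed (use less k in \<open>auto simp: less_imp_le\<close>)
  then show ?thesis using False by (simp add: max_def)
qed

text \<open>
  Below the second knot the active variables are \<open>j\<close> and \<open>k\<close>; their coefficients solve the two equations
  saying that the residual correlations are \<open>s l\<close> and \<open>s' l\<close>.
\<close>
definition coeff_k :: "real \<Rightarrow> real" where
  "coeff_k l = s' * (knot2 - l) * (1 - s * s' * R k j) / (1 - (R k j)\<^sup>2)"

definition coeff_j :: "real \<Rightarrow> real" where
  "coeff_j l = s * (knot1 - l) - coeff_k l * R k j"

lemma R_bounds: "0 < 1 - s * s' * R k j" "0 < 1 - (R k j)\<^sup>2"
  using sign_mult_bound(1)[OF corr[OF j(1) k(1,2)] j(2) k(3)] corr[OF j(1) k(1,2)]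
  by (simp_all add: abs_square_less_1)

text \<open>The coefficients are chosen so that the correlations at \<open>j\<close> and
  \<open>k\<close> are exactly \<open>s * l\<close> and \<open>s' * l\<close>; the sign of
  \<open>coeff_k\<close> is right because \<open>l\<close> is at most the second knot. The sign of
  \<open>coeff_j\<close> and the strict bounds at the other columns are assumed here and checked
  near the knot below.\<close>

lemma lasso_after_second:
  assumes l: "0 < l" "l \<le> knot2" and pos: "0 \<le> s * coeff_j l"
    and rest: "\<And>i. i < p \<Longrightarrow> i \<noteq> j \<Longrightarrow> i \<noteq> k \<Longrightarrow> \<bar>U i - coeff_j l * R i j - coeff_k l * R i k\<bar> < l"
  shows "lasso X y l = two_vec p j k (coeff_j l) (coeff_k l)"
proof (rule lasso_two_vec[OF j(1) k(1,2)])
  have abs_s: "\<bar>s\<bar> = 1" "\<bar>s'\<bar> = 1" using j k by auto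
  have gj: "U j - coeff_j l - coeff_k l * R k j = s * l"
    unfolding coeff_j_def using U_j by (simp add: algebra_simps)
  show "\<bar>U j - coeff_j l - coeff_k l * R k j\<bar> \<le> l" unfolding gj using l abs_s by (simp add: abs_mult)
  have "\<bar>coeff_j l\<bar> = s * coeff_j l" using pos j(2) by auto
  then show "(U j - coeff_j l - coeff_k l * R k j) * coeff_j l = l * \<bar>coeff_j l\<bar>"
    unfolding gj by simp
  \<comment> \<open>The runner-up equation solved for the residual of column
    \<open>k\<close>.\<close>
  have V: "U k - R k j * U j = s' * knot2 * (1 - s * s' * R k j)"
  proof -
    have "s' * (U k - R k j * U j) = knot2 * (1 - s * s' * R k j)"
      using runner R_bounds(1) by (simp add: entry_value_def field_simps)
    then have "s' * (s' * (U k - R k j * U j)) = s' * (knot2 * (1 - s * s' * R k j))" by simp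
    then show ?thesis by (simp only: ss mult.assoc)
  qed
  have b: "coeff_k l * (1 - (R k j)\<^sup>2) = s' * (knot2 - l) * (1 - s * s' * R k j)"
    using R_bounds(2) by (simp add: coeff_k_def)
  have "U k - coeff_j l * R k j - coeff_k l = (U k - R k j * U j) + s * l * R k j - coeff_k l * (1 - (R k j)\<^sup>2)"
    unfolding coeff_j_def using U_j by (simp add: power2_eq_square algebra_simps ss)
  also have "\<dots> = s' * l * (1 - s * s' * R k j) + s * l * R k j" unfolding V b by (simp add: algebra_simps)
  also have "\<dots> = s' * l" by (simp add: algebra_simps ss)
  finally have gk: "U k - coeff_j l * R k j - coeff_k l = s' * l" .
  show "\<bar>U k - coeff_j l * R k j - coeff_k l\<bar> \<le> l" unfolding gk using l abs_s by (simp add: abs_mult)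
  have "0 \<le> (knot2 - l) * (1 - s * s' * R k j) / (1 - (R k j)\<^sup>2)" using R_bounds l by simp
  also have "\<dots> = s' * coeff_k l" by (simp add: coeff_k_def ss mult.assoc)
  finally have "\<bar>coeff_k l\<bar> = s' * coeff_k l" using k(3) by auto
  then show "(U k - coeff_j l * R k j - coeff_k l) * coeff_k l = l * \<bar>coeff_k l\<bar>"
    unfolding gk by simp
qed (rule rest)

lemma coeff_at_second: "coeff_k knot2 = 0" "coeff_j knot2 = s * (knot1 - knot2)"
  by (simp_all add: coeff_j_def coeff_k_def)

lemma rest_at_second:
  assumes "i < p" "i \<noteq> j" "i \<noteq> k"
  shows "\<bar>U i - coeff_j knot2 * R i j - coeff_k knot2 * R i k\<bar> < knot2"
  unfolding coeff_at_second using assms strict by (simp, intro abs_residual_less) auto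

lemma lasso_at_second: "lasso X y knot2 = two_vec p j k (s * (knot1 - knot2)) 0"
  using lasso_after_second[OF second_pos order.refl _ rest_at_second] first
  by (simp add: coeff_at_second ss)

text \<open>The conditions left open hold strictly at the second knot, and the coefficients are
  continuous in \<open>l\<close>, so they persist slightly below it. This suffices to see
  \<open>k\<close> enter.\<close>

lemma eventually_lasso_after_second:
  "eventually (\<lambda>l. lasso X y l = two_vec p j k (coeff_j l) (coeff_k l)) (at_left knot2)"
proof -
  have ck: "(coeff_k \<longlongrightarrow> coeff_k knot2) (at_left knot2)"
    unfolding coeff_k_def by (intro tendsto_intros) (use R_bounds in auto)
  then have cj: "(coeff_j \<longlongrightarrow> coeff_j knot2) (at_left knot2)"
    unfolding coeff_j_def by (intro tendsto_intros) auto
  have "((\<lambda>l. s * coeff_j l) \<longlongrightarrow> s * coeff_j knot2) (at_left knot2)" by (intro tendsto_intros cj)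
  moreover have "0 < s * coeff_j knot2" using first by (simp add: coeff_at_second ss)
  ultimately have e1: "eventually (\<lambda>l. 0 < s * coeff_j l) (at_left knot2)" by (rule order_tendstoD)
  have "eventually (\<lambda>l. \<bar>U i - coeff_j l * R i j - coeff_k l * R i k\<bar> - l < 0) (at_left knot2)"
    if "i \<in> {..<p} - {j, k}" for i
  proof -
    have "((\<lambda>l. \<bar>U i - coeff_j l * R i j - coeff_k l * R i k\<bar> - l) \<longlongrightarrow>
       \<bar>U i - coeff_j knot2 * R i j - coeff_k knot2 * R i k\<bar> - knot2) (at_left knot2)"
      by (intro tendsto_intros cj ck)
    then show ?thesis by (rule order_tendstoD) (use that rest_at_second in auto)
  qed
  then have e2: "eventually (\<lambda>l. \<forall>i\<in>{..<p} - {j, k}. \<bar>U i - coeff_j l * R i j - coeff_k l * R i k\<bar> - l < 0) (at_left knot2)"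
    by (intro eventually_ball_finite) auto
  have e3: "eventually (\<lambda>l. l \<in> {0<..<knot2}) (at_left knot2)"
    using second_pos by (rule eventually_at_left_real)
  from e1 e2 e3 show ?thesis
  proof eventually_elim
    case (elim l)
    then show ?case by (intro lasso_after_second) auto
  qed
qed

lemma active_set_before_second:
  assumes "knot2 < l"
  shows "active_set X y l = (if l < knot1 then {j} else {})"
  unfolding active_set_def lasso_before_second[OF assms]
  using j k X by (auto simp: two_vec_def max_def split: if_splits)

lemma k_enters: "enters_at X y knot2 k"
  unfolding enters_at_def
proof
  have "eventually (\<lambda>l. knot2 < l) (at_right knot2)" by (rule eventually_at_right_less)
  then show "eventually (\<lambda>l. k \<notin> active_set X y l) (at_right knot2)"
    by eventually_elim (use k in \<open>simp add: active_set_before_second\<close>)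
  have "eventually (\<lambda>l. l \<in> {0<..<knot2}) (at_left knot2)"
    using second_pos by (rule eventually_at_left_real)
  with eventually_lasso_after_second show "eventually (\<lambda>l. k \<in> active_set X y l) (at_left knot2)"
  proof eventually_elim
    case (elim l)
    have "coeff_k l \<noteq> 0" using elim R_bounds k(3) by (auto simp: coeff_k_def)
    then show ?case using elim(1) k X by (auto simp: active_set_def two_vec_def)
  qed
qed

lemma j_enters: "enters_at X y knot1 j"
  unfolding enters_at_def
proof
  have "eventually (\<lambda>l. knot1 < l) (at_right knot1)" by (rule eventually_at_right_less)
  then show "eventually (\<lambda>l. j \<notin> active_set X y l) (at_right knot1)"
    by eventually_elim (use first in \<open>simp add: active_set_before_second\<close>)
  have "eventually (\<lambda>l. l \<in> {knot2<..<knot1}) (at_left knot1)"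
    using first by (rule eventually_at_left_real)
  then show "eventually (\<lambda>l. j \<in> active_set X y l) (at_left knot1)"
    by eventually_elim (simp add: active_set_before_second)
qed

text \<open>Except at the entry of \<open>j\<close>, membership of \<open>i\<close> in the active
  set has the same constant truth value on both sides of \<open>m\<close>, so \<open>i\<close>
  neither enters nor leaves there.\<close>

lemma events_before_second:
  assumes ev: "(m, i) \<in> path_events X y" and m: "knot2 < m"
  shows "m = knot1 \<and> i = j"
proof (rule ccontr)
  assume *: "\<not> (m = knot1 \<and> i = j)"
  have left: "eventually (\<lambda>l. (i \<in> active_set X y l) = (i = j \<and> m < knot1)) (at_left m)"
  proof (cases "m \<le> knot1")
    case True
    have "eventually (\<lambda>l. l \<in> {knot2<..<m}) (at_left m)" using m by (rule eventually_at_left_real)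
    then show ?thesis by eventually_elim (use True * in \<open>auto simp: active_set_before_second\<close>)
  next
    case False
    then have "eventually (\<lambda>l. l \<in> {knot1<..<m}) (at_left m)" by (intro eventually_at_left_real) simp
    then show ?thesis by eventually_elim (use False first in \<open>auto simp: active_set_before_second\<close>)
  qed
  have right: "eventually (\<lambda>l. (i \<in> active_set X y l) = (i = j \<and> m < knot1)) (at_right m)"
  proof (cases "m < knot1")
    case True
    then have "eventually (\<lambda>l. l \<in> {m<..<knot1}) (at_right m)" by (rule eventually_at_right_real)
    then show ?thesis by eventually_elim (use True m in \<open>auto simp: active_set_before_second\<close>)
  next
    case False
    have "eventually (\<lambda>l. m < l) (at_right m)" by (rule eventually_at_right_less)
    then show ?thesis by eventually_elim (use False m in \<open>auto simp: active_set_before_second\<close>)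
  qed
  have const: "Q = B"
    if "F \<noteq> bot" "eventually (\<lambda>l. (i \<in> active_set X y l) = B) F" "eventually (\<lambda>l. (i \<in> active_set X y l) = Q) F"
    for F :: "real filter" and Q B
  proof -
    from that(2,3) have "eventually (\<lambda>l. Q = B) F" by eventually_elim simp
    then show ?thesis using that(1) by (simp add: eventually_const)
  qed
  from ev consider "enters_at X y m i" | "leaves_at X y m i" by (auto simp: path_events_def)
  then show False
  proof cases
    case 1
    then show False
      using const[OF trivial_limit_at_left_real left, of True] const[OF trivial_limit_at_right_real right, of False]
      unfolding enters_at_def by simp
  next
    case 2
    then show False
      using const[OF trivial_limit_at_left_real left, of False] const[OF trivial_limit_at_right_real right, of True]
      unfolding leaves_at_def by simp
  qed
qed

lemma lasso_knot_2: "lasso_knot X y 2 = knot2"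
  unfolding lasso_knot_def
proof (rule cSup_eq_maximum)
  let ?ev = "\<lambda>l. {(m, i). (m, i) \<in> path_events X y \<and> l \<le> m}"
  \<comment> \<open>Finiteness matters because \<open>card\<close> of an infinite set is 0. It holds
    since every event at or above the second knot is the entry of \<open>j\<close> or lies at the
    second knot itself.\<close>
  have "?ev knot2 \<subseteq> insert (knot1, j) ({knot2} \<times> {..<p})"
  proof
    fix a assume a: "a \<in> ?ev knot2"
    obtain m i where ai: "a = (m, i)" by (cases a)
    with a have *: "(m, i) \<in> path_events X y" "knot2 \<le> m" by auto
    then have "i < p" using X by (auto simp: path_events_def)
    then show "a \<in> insert (knot1, j) ({knot2} \<times> {..<p})"
      using events_before_second[OF *(1)] *(2) ai by (cases "m = knot2") auto
  qed
  then have fin: "finite (?ev knot2)" by (rule finite_subset) simp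
  have "{(knot1, j), (knot2, k)} \<subseteq> ?ev knot2"
    using j k X first second_pos j_enters k_enters by (auto simp: path_events_def)
  then have "card {(knot1, j), (knot2, k)} \<le> card (?ev knot2)" by (intro card_mono fin)
  then have "2 \<le> card (?ev knot2)" using k by simp
  then show "knot2 \<in> insert 0 {l. 0 < l \<and> 2 \<le> card (?ev l)}" using second_pos by simp
  fix l assume l: "l \<in> insert 0 {l. 0 < l \<and> 2 \<le> card (?ev l)}"
  show "l \<le> knot2"
  proof (rule ccontr)
    assume "\<not> l \<le> knot2"
    then have gt: "knot2 < l" by simp
    then have "?ev l \<subseteq> {(knot1, j)}" using events_before_second by fastforce
    then have "card (?ev l) \<le> card {(knot1, j)}" by (intro card_mono) auto
    then show False using l gt second_pos by auto
  qed
qed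

lemma cov_test_stat1_eq: "cov_test_stat1 X y \<sigma> = knot1 * (knot1 - knot2) / \<sigma>\<^sup>2"
proof -
  let ?v = "two_vec p j k (s * (knot1 - knot2)) 0"
  have v: "?v \<in> carrier_vec p" by (simp add: two_vec_def)
  then have Xv: "X *\<^sub>v ?v \<in> carrier_vec n" using X by auto
  have "y \<bullet> (X *\<^sub>v ?v) = (X *\<^sub>v ?v) \<bullet> y" using y Xv by (rule comm_scalar_prod)
  also have "\<dots> = (\<Sum>i<p. ?v $ i * U i)" using X v y by (rule mult_mat_vec_scalar_prod)
  also have "\<dots> = ?v $ j * U j + ?v $ k * U k"
    using j k by (intro two_vec_sum) (auto simp: two_vec_def)
  also have "\<dots> = knot1 * (knot1 - knot2)" using j k by (simp add: two_vec_def)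
  finally show ?thesis by (simp add: cov_test_stat1_def lasso_knot_2 lasso_at_second)
qed

end

section \<open>General position and partial variances\<close>

lemma affine_subspace_singleton:
  assumes "a \<in> carrier_vec n"
  shows "affine_subspace n 0 {a}"
proof -
  let ?V = "module_vec TYPE(real) n" and ?W = "{0\<^sub>v n :: real vec}"
  have sub: "subspace class_ring ?W ?V"
    unfolding subspace_def submodule_def
    using vec_vs[of n] vec_module[of n] by (auto simp: module_vec_simps)
  then interpret W: vectorspace class_ring "?V\<lparr>carrier := ?W\<rparr>"
    by (rule vectorspace.subspace_is_vs[OF vec_vs])
  have z: "zero (?V\<lparr>carrier := ?W\<rparr>) = 0\<^sub>v n" by (simp add: module_vec_def)
  have "W.gen_set {zero (?V\<lparr>carrier := ?W\<rparr>)}"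
  proof
    show "W.span {zero (?V\<lparr>carrier := ?W\<rparr>)} \<subseteq> carrier (?V\<lparr>carrier := ?W\<rparr>)"
      by (rule W.span_is_subset2) (simp add: z)
    show "carrier (?V\<lparr>carrier := ?W\<rparr>) \<subseteq> W.span {zero (?V\<lparr>carrier := ?W\<rparr>)}"
      using W.in_own_span[of "{zero (?V\<lparr>carrier := ?W\<rparr>)}"] by (simp add: z)
  qed
  then have "W.dim = 0" by (rule W.dim0I)
  then show ?thesis
    unfolding affine_subspace_def using sub assms
    by (intro bexI[of _ a] exI[of _ ?W] conjI) auto
qed

text \<open>This is general position in dimension 0. Were the inner product at least 1 in absolute
  value, \<open>col X j\<close> minus the suitably signed \<open>col X k\<close> would have squared
  length at most 0, and a single point would contain two signed columns.\<close>

lemma general_position_corr: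
  assumes X: "X \<in> carrier_mat n p" and gp: "columns_in_general_position X"
    and unit: "\<And>j. j < p \<Longrightarrow> col X j \<bullet> col X j = 1"
    and jk: "j < p" "k < p" "k \<noteq> j"
  shows "\<bar>col X k \<bullet> col X j\<bar> < 1"
proof (rule ccontr)
  assume ge: "\<not> \<bar>col X k \<bullet> col X j\<bar> < 1"
  define c :: real where "c = (if 0 \<le> col X k \<bullet> col X j then 1 else - 1)"
  have c: "c \<in> {1, - 1}" "1 \<le> c * (col X k \<bullet> col X j)"
    using ge by (auto simp: c_def)
  have carr: "col X j \<in> carrier_vec n" "col X k \<in> carrier_vec n" using X by auto
  have n: "n > 0"
  proof (rule ccontr)
    assume "\<not> n > 0"
    then have "col X j \<bullet> col X j = 0" using X by (simp add: scalar_prod_def)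
    then show False using unit[OF jk(1)] by simp
  qed
  define w where "w = col X j - c \<cdot>\<^sub>v col X k"
  have w: "w \<in> carrier_vec n" using carr by (simp add: w_def)
  have "w \<bullet> w = 1 - 2 * c * (col X k \<bullet> col X j) + c * c"
    unfolding w_def using carr unit[OF jk(1)] unit[OF jk(2)] comm_scalar_prod[OF carr]
    by (simp add: minus_scalar_prod_distrib[of _ n] scalar_prod_minus_distrib[of _ n] algebra_simps)
  also have "\<dots> \<le> 0" using c by auto
  finally have "w \<bullet> w \<le> 0" .
  moreover have "w \<bullet> w = (\<Sum>i<n. w $ i * w $ i)" using w by (simp add: scalar_prod_def lessThan_atLeast0)
  ultimately have "(\<Sum>i<n. w $ i * w $ i) = 0" by (simp add: sum_nonneg antisym)
  then have "\<forall>i\<in>{..<n}. w $ i * w $ i = 0" by (subst (asm) sum_nonneg_eq_0_iff) auto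
  then have eq: "c \<cdot>\<^sub>v col X k = col X j"
  proof (intro eq_vecI)
    fix i assume "i < dim_vec (col X j)"
    then have "i < n" using X by simp
    then have "w $ i = col X j $ i - c * col X k $ i" "w $ i = 0"
      using \<open>\<forall>i\<in>{..<n}. w $ i * w $ i = 0\<close> X by (auto simp: w_def)
    then show "(c \<cdot>\<^sub>v col X k) $ i = col X j $ i" using \<open>i < n\<close> X by simp
  qed simp
  let ?s = "\<lambda>i. if i = j then 1 else c"
  have "card {j, k} \<le> 0 + 1"
  proof (rule gp[unfolded columns_in_general_position_def, rule_format, of 0 "{col X j}" "{j, k}" ?s])
    show "0 < min (dim_row X) (dim_col X)" using X n jk by auto
    show "affine_subspace (dim_row X) 0 {col X j}" using X by (intro affine_subspace_singleton) auto
    show "{j, k} \<subseteq> {..<dim_col X}" using X jk by auto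
    have "1 \<cdot>\<^sub>v col X j = col X j" by auto
    then show "(\<forall>i\<in>{j, k}. ?s i \<in> {1, - 1}) \<and> (\<forall>i\<in>{j, k}. ?s i \<cdot>\<^sub>v col X i \<in> {col X j})"
      using c eq jk by auto
  qed
  then show False using jk by simp
qed

lemma dot_eq_scalar_prod:
  assumes "X \<in> carrier_mat n p" "v \<in> carrier_vec n"
  shows "dot n (\<lambda>i. X $$ (i, k)) (\<lambda>i\<in>{..<n}. v $ i) = col X k \<bullet> v"
    "dot n (\<lambda>i. X $$ (i, k)) (\<lambda>i. X $$ (i, j)) = col X k \<bullet> col X j"
  using assms by (auto simp: dot_def scalar_prod_def col_def lessThan_atLeast0)

lemma dot_sub_sum:
  "dot n v (\<lambda>i. a i - (\<Sum>k\<in>K. c k * b k i)) = dot n v a - (\<Sum>k\<in>K. c k * dot n v (b k))"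
proof -
  have "(\<Sum>i<n. v i * (\<Sum>k\<in>K. c k * b k i)) = (\<Sum>k\<in>K. c k * dot n v (b k))"
    unfolding dot_def sum_distrib_left by (subst sum.swap) (simp add: algebra_simps)
  then show ?thesis by (simp add: dot_def right_diff_distrib sum_subtractf)
qed

text \<open>The direction is the normalised residual of the projection of \<open>X\<^sub>i\<close> onto the other columns in \<open>S\<close>.\<close>
lemma partial_variance_direction:
  assumes X: "X \<in> carrier_mat n p" and S: "S \<subseteq> {..<p}" "i \<in> S" and unit: "col X i \<bullet> col X i = 1"
    and inv: "invertible_mat (submatrix (transpose_mat X * X) (S - {i}) (S - {i}))"
    and pv: "\<delta>\<^sup>2 \<le> partial_variance (transpose_mat X * X) S i" and "0 < \<delta>"
  shows "\<exists>e. dot n e e = 1 \<and> (\<forall>k\<in>S - {i}. dot n (\<lambda>r. X $$ (r, k)) e = 0) \<and> \<delta> \<le> dot n (\<lambda>r. X $$ (r, i)) e"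
proof -
  define T m where "T = S - {i}" and "m = card T"
  define R where "R = transpose_mat X * X"
  let ?x = "\<lambda>k r. X $$ (r, k)"
  have T: "finite T" "T \<subseteq> {..<p}" "i < p" using S by (auto simp: T_def intro: finite_subset)
  have R: "R \<in> carrier_mat p p" using X by (simp add: R_def)
  have Rdot: "R $$ (a, b) = dot n (?x a) (?x b)" if "a < p" "b < p" for a b
    using X that dot_eq_scalar_prod(2)[OF X zero_carrier_vec, of a b] by (simp add: R_def)
  have dims: "card {a. a < dim_row R \<and> a \<in> T} = m" "card {a. a < dim_col R \<and> a \<in> T} = m"
    "card {a. a < dim_row R \<and> a \<in> {i}} = 1" "card {a. a < dim_col R \<and> a \<in> {i}} = 1"
  proof -
    have "{a. a < p \<and> a \<in> T} = T" "{a. a < p \<and> a \<in> {i}} = {i}" using T by auto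
    then show "card {a. a < dim_row R \<and> a \<in> T} = m" "card {a. a < dim_col R \<and> a \<in> T} = m"
      "card {a. a < dim_row R \<and> a \<in> {i}} = 1" "card {a. a < dim_col R \<and> a \<in> {i}} = 1"
      using R by (auto simp: m_def)
  qed
  define G C D where "G = submatrix R T T" and "C = submatrix R T {i}" and "D = submatrix R {i} T"
  have carr: "G \<in> carrier_mat m m" "C \<in> carrier_mat m 1" "D \<in> carrier_mat 1 m"
    unfolding G_def C_def D_def using dims by (auto intro!: carrier_matI simp: dim_submatrix)
  have pickT: "pick T a \<in> T" "pick T a < p" if "a < m" for a
    using pick_in_set_le[of a T] that T(2) by (auto simp: m_def)
  have picki: "pick {i} 0 = i" by (simp add: Least_equality)
  have G: "G $$ (a, b) = dot n (?x (pick T a)) (?x (pick T b))" if "a < m" "b < m" for a b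
    using that dims pickT Rdot unfolding G_def by (simp add: submatrix_index)
  have C: "C $$ (a, 0) = dot n (?x (pick T a)) (?x i)" if "a < m" for a
    using that dims pickT Rdot T(3) unfolding C_def by (simp add: submatrix_index picki del: pick.simps)
  have D: "D $$ (0, a) = dot n (?x i) (?x (pick T a))" if "a < m" for a
    using that dims pickT Rdot T(3) unfolding D_def by (simp add: submatrix_index picki del: pick.simps)
  obtain B where B: "mat_inverse G = Some B" "G * B = 1\<^sub>m m" "B \<in> carrier_mat m m"
  proof (cases "mat_inverse G")
    case None
    have "G \<in> Units (ring_mat TYPE(real) m ())"
    proof -
      from inv obtain B where "inverts_mat G B" "inverts_mat B G"
        by (auto simp: invertible_mat_def G_def R_def T_def)
      then have B: "G * B = 1\<^sub>m m" "B * G = 1\<^sub>m (dim_row B)"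
        using carr by (auto simp: inverts_mat_def)
      from arg_cong[OF B(1), of dim_col] arg_cong[OF B(2), of dim_col] have "B \<in> carrier_mat m m"
        using carr by auto
      then show ?thesis using B carr by (auto simp: Units_def ring_mat_def)
    qed
    then show ?thesis using mat_inverse(1)[OF carr(1) None, of "()"] by simp
  next
    case (Some B)
    then show ?thesis using that mat_inverse(2)[OF carr(1)] by blast
  qed
  \<comment> \<open>The coefficients of the least squares regression of column \<open>i\<close> on
    the columns in \<open>T\<close>; \<open>Gc\<close> states their normal equations.\<close>
  define c where "c a = (B * C) $$ (a, 0)" for a
  have BC: "B * C \<in> carrier_mat m 1" using B carr by simp
  have Gc: "(\<Sum>b<m. c b * G $$ (a, b)) = C $$ (a, 0)" if "a < m" for a
  proof -
    have "G * (B * C) = C" using B carr assoc_mult_mat[of G m m B m C 1] by simp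
    then have "C $$ (a, 0) = (G * (B * C)) $$ (a, 0)" by simp
    also have "\<dots> = (\<Sum>b<m. G $$ (a, b) * (B * C) $$ (b, 0))"
      using that carr BC by (simp add: scalar_prod_def lessThan_atLeast0 del: index_mult_mat(1))
        (subst index_mult_mat(1), auto simp: scalar_prod_def)
    finally show ?thesis by (simp add: c_def mult.commute)
  qed
  have pv_eq: "partial_variance R S i = 1 - (\<Sum>a<m. c a * D $$ (0, a))"
  proof -
    have "(D * B * C) $$ (0, 0) = (D * (B * C)) $$ (0, 0)"
      using B carr assoc_mult_mat[of D 1 m B m C 1] by simp
    also have "\<dots> = (\<Sum>b<m. D $$ (0, b) * (B * C) $$ (b, 0))"
      using carr BC by (subst index_mult_mat(1)) (auto simp: scalar_prod_def lessThan_atLeast0)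
    finally show ?thesis
      using B(1) by (simp add: partial_variance_def D_def C_def G_def T_def c_def mult.commute)
  qed
  define res where "res r = ?x i r - (\<Sum>a<m. c a * ?x (pick T a) r)" for r
  have dot_res: "dot n v res = dot n v (?x i) - (\<Sum>a<m. c a * dot n v (?x (pick T a)))" for v
    unfolding res_def by (rule dot_sub_sum)
  have orth: "dot n (?x (pick T a)) res = 0" if "a < m" for a
    using Gc[OF that] that by (simp add: dot_res C G)
  have xi: "dot n (?x i) res = partial_variance R S i"
    using unit dot_eq_scalar_prod(2)[OF X zero_carrier_vec, of i i] by (simp add: dot_res pv_eq D)
  have "dot n res res = dot n res (?x i) - (\<Sum>a<m. c a * dot n res (?x (pick T a)))" by (rule dot_res)
  then have rr: "dot n res res = partial_variance R S i"
    using orth xi by (simp add: dot_commute[of n res "?x _"])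
  \<comment> \<open>The length of the residual \<open>res\<close>, by \<open>rr\<close>.\<close>
  define q where "q = sqrt (partial_variance R S i)"
  have q: "\<delta> \<le> q" using pv by (simp add: q_def R_def real_le_rsqrt)
  have q2: "q * q = partial_variance R S i"
    using order_trans[OF zero_le_power2 pv] by (simp add: q_def R_def)
  have q0: "0 < q" using q \<open>0 < \<delta>\<close> by simp
  let ?e = "\<lambda>r. (1 / q) * res r"
  show ?thesis
  proof (intro exI[of _ ?e] conjI ballI)
    show "dot n ?e ?e = 1" unfolding dot_scale rr q2[symmetric] using q0 by simp
    show "\<delta> \<le> dot n (?x i) ?e" unfolding dot_scale xi q2[symmetric] using q q0 by simp
    fix k assume k: "k \<in> S - {i}"
    then have kT: "k \<in> T" by (simp add: T_def)
    have "{a \<in> T. a < k} \<subset> T" using kT by blast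
    \<comment> \<open>The number of elements of \<open>T\<close> below \<open>k\<close> is the
      position at which \<open>pick\<close> returns \<open>k\<close>.\<close>
    then have "card {a \<in> T. a < k} < m" unfolding m_def using T(1) by (intro psubset_card_mono)
    from orth[OF this] show "dot n (?x k) ?e = 0"
      unfolding dot_scale using pick_card_in_set[OF kT] by simp
  qed
qed

section \<open>The limiting distribution\<close>

lemma isotropic_gaussian_distr:
  assumes "isotropic_gaussian M n \<sigma> y" "0 < n"
  shows "(\<lambda>\<omega>. \<lambda>i\<in>{..<n}. y \<omega> $ i) \<in> M \<rightarrow>\<^sub>M PiM {..<n} (\<lambda>_. borel)"
    "distr M (PiM {..<n} (\<lambda>_. borel)) (\<lambda>\<omega>. \<lambda>i\<in>{..<n}. y \<omega> $ i) = normal_product n \<sigma>"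
proof -
  interpret prob_space M using assms by (simp add: isotropic_gaussian_def)
  have indep: "indep_vars (\<lambda>_. borel) (\<lambda>i \<omega>. y \<omega> $ i) {..<n}"
    and dist: "\<And>i. i < n \<Longrightarrow> distributed M lborel (\<lambda>\<omega>. y \<omega> $ i) (normal_density 0 \<sigma>)"
    using assms by (auto simp: isotropic_gaussian_def)
  have rv: "random_variable borel (\<lambda>\<omega>. y \<omega> $ i)" if "i < n" for i
    using distributed_measurable[OF dist[OF that]] by simp
  then show "(\<lambda>\<omega>. \<lambda>i\<in>{..<n}. y \<omega> $ i) \<in> M \<rightarrow>\<^sub>M PiM {..<n} (\<lambda>_. borel)"
    by (intro measurable_restrict) auto
  have "distr M borel (\<lambda>\<omega>. y \<omega> $ i) = normal_measure \<sigma>" if "i < n" for i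
  proof -
    have "distr M borel (\<lambda>\<omega>. y \<omega> $ i) = distr M lborel (\<lambda>\<omega>. y \<omega> $ i)"
      by (intro distr_cong) auto
    then show ?thesis using distributed_distr_eq_density[OF dist[OF that]] by simp
  qed
  moreover have "distr M (PiM {..<n} (\<lambda>_. borel)) (\<lambda>\<omega>. \<lambda>i\<in>{..<n}. y \<omega> $ i) =
      PiM {..<n} (\<lambda>i. distr M borel (\<lambda>\<omega>. y \<omega> $ i))"
    using indep rv assms(2) by (subst (asm) indep_vars_iff_distr_eq_PiM') auto
  moreover have "PiM {..<n} (\<lambda>i. distr M borel (\<lambda>\<omega>. y \<omega> $ i)) = normal_product n \<sigma>"
    using calculation(1) by (intro PiM_cong) auto
  ultimately show "distr M (PiM {..<n} (\<lambda>_. borel)) (\<lambda>\<omega>. \<lambda>i\<in>{..<n}. y \<omega> $ i) = normal_product n \<sigma>"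
    by simp
qed

text \<open>The test statistic is identified with a measurable function of \<open>y\<close> only
  almost everywhere, so its events are measured in the completion.\<close>

lemma measure_completion_AE_eq:
  assumes B: "{\<omega> \<in> space M. Q \<omega>} \<in> sets M" and ae: "AE \<omega> in M. P \<omega> \<longleftrightarrow> Q \<omega>"
  shows "measure (completion M) {\<omega> \<in> space M. P \<omega>} = measure M {\<omega> \<in> space M. Q \<omega>}"
proof -
  have [measurable]: "Measurable.pred (completion M) Q"
    using B by (simp add: pred_def)
  have [measurable]: "Measurable.pred (completion M) (\<lambda>\<omega>. P \<omega> \<noteq> Q \<omega>)"
    using ae by (intro sets_completion_AE) auto
  have "Measurable.pred (completion M) (\<lambda>\<omega>. Q \<omega> \<noteq> (P \<omega> \<noteq> Q \<omega>))" by measurable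
  then have P: "{\<omega> \<in> space M. P \<omega>} \<in> sets (completion M)"
  proof -
    have "{\<omega> \<in> space M. P \<omega>} = {\<omega> \<in> space (completion M). Q \<omega> \<noteq> (P \<omega> \<noteq> Q \<omega>)}" by auto
    also have "\<dots> \<in> sets (completion M)"
      using \<open>Measurable.pred (completion M) (\<lambda>\<omega>. Q \<omega> \<noteq> (P \<omega> \<noteq> Q \<omega>))\<close> by (simp only: pred_def)
    finally show ?thesis .
  qed
  have "measure (completion M) {\<omega> \<in> space M. P \<omega>} = measure (completion M) {\<omega> \<in> space M. Q \<omega>}"
    by (rule measure_eq_AE) (use AE_completion[OF ae] P B in auto)
  then show ?thesis using B by simp
qed

text \<open>Outside the null sets of ties the observation satisfies \<open>first_step\<close> for
  the winner and its runner-up pair, which gives the statistic in closed form. Uniqueness of the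
  winner then turns membership in the union into the condition for this one index.\<close>

lemma prob_cov_test_stat1:
  assumes p: "2 \<le> p" and X: "X \<in> carrier_mat n p" and "0 < \<sigma>"
    and unit: "\<And>j. j < p \<Longrightarrow> col X j \<bullet> col X j = 1"
    and corr: "\<And>j k. j < p \<Longrightarrow> k < p \<Longrightarrow> k \<noteq> j \<Longrightarrow> \<bar>col X k \<bullet> col X j\<bar> < 1"
    and y: "isotropic_gaussian M n \<sigma> y"
  shows "measure (completion M) {\<omega> \<in> space M. t < cov_test_stat1 X (y \<omega>) \<sigma>} =
    measure (normal_product n \<sigma>) (\<Union>(gaussian_design.wins n p \<sigma> (\<lambda>k i. X $$ (i, k)) (t * \<sigma>\<^sup>2) ` ({..<p} \<times> {1, - 1})))"
proof -
  let ?x = "\<lambda>k i. X $$ (i, k)"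
  interpret D: gaussian_design n p \<sigma> ?x
    using assms dot_eq_scalar_prod(2)[OF X zero_carrier_vec] by unfold_locales auto
  have n: "0 < n"
  proof (rule ccontr)
    assume "\<not> 0 < n"
    then have "col X 0 \<bullet> col X 0 = 0" using X by (simp add: scalar_prod_def)
    then show False using unit[of 0] p by simp
  qed
  define f where "f \<omega> = (\<lambda>i\<in>{..<n}. y \<omega> $ i)" for \<omega>
  note distr = isotropic_gaussian_distr[OF y n, folded f_def]
  note [measurable] = distr(1)
  let ?W = "\<Union>(D.wins (t * \<sigma>\<^sup>2) ` ({..<p} \<times> {1, - 1}))"
  have Wset: "?W \<in> sets (PiM {..<n} (\<lambda>_. borel))"
    using D.wins_measurable by (simp add: sets_normal_product sets.finite_UN)
  have generic: "cov_test_stat1 X (y \<omega>) \<sigma> > t \<longleftrightarrow> f \<omega> \<in> ?W"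
    if \<omega>: "\<omega> \<in> space M"
      and dist: "\<forall>j<p. \<forall>k<p. k \<noteq> j \<longrightarrow> \<bar>D.U (f \<omega>) k\<bar> \<noteq> \<bar>D.U (f \<omega>) j\<bar>"
      and inj: "\<forall>j<p. \<forall>s\<in>{1, - 1}. inj_on (entry_value D.R (D.U (f \<omega>)) j s) (({..<p} - {j}) \<times> {1, - 1})" for \<omega>
  proof -
    have yc: "y \<omega> \<in> carrier_vec n" using y \<omega> by (simp add: isotropic_gaussian_def)
    have fP: "f \<omega> \<in> space (normal_product n \<sigma>)"
      using measurable_space[OF distr(1) \<omega>] by (simp add: space_normal_product)
    have R: "D.R = (\<lambda>k j. col X k \<bullet> col X j)" using dot_eq_scalar_prod(2)[OF X yc] by auto
    have U: "D.U (f \<omega>) = (\<lambda>k. col X k \<bullet> y \<omega>)" unfolding f_def using dot_eq_scalar_prod(1)[OF X yc] by auto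
    have U': "D.U (f \<omega>) k = col X k \<bullet> y \<omega>" for k using fun_cong[OF U] .
    from D.winner_exists[OF dist] obtain j s where j: "j < p" "s \<in> {1, - 1}"
      and win: "D.second j s (f \<omega>) < s * D.U (f \<omega>) j" by blast
    let ?I = "({..<p} - {j}) \<times> {1, - 1 :: real}"
    let ?ev = "entry_value D.R (D.U (f \<omega>)) j s"
    have inj_j: "inj_on ?ev ?I" using inj j by blast
    have ne: "?I \<noteq> {}"
    proof -
      have "(if j = 0 then 1 else 0) \<in> {..<p} - {j}" using p by auto
      then show ?thesis by blast
    qed
    have "Max (?ev ` ?I) \<in> ?ev ` ?I" using ne by (intro Max_in) auto
    then obtain a where a: "a \<in> ?I" "Max (?ev ` ?I) = ?ev a" by blast
    obtain k s' where ks: "a = (k, s')" by (cases a)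
    have k: "k < p" "k \<noteq> j" "s' \<in> {1, - 1}" and max: "?ev (k, s') = D.second j s (f \<omega>)"
      using a ks by (auto simp: runner_up_def)
    have strict: "?ev (i, r) < D.second j s (f \<omega>)"
      if "i < p" "i \<noteq> j" "r \<in> {1, - 1}" "(i, r) \<noteq> (k, s')" for i r
    proof -
      have "?ev (i, r) \<noteq> ?ev (k, s')" using inj_onD[OF inj_j, of "(i, r)" "(k, s')"] that k by auto
      then show ?thesis using runner_up_ge[OF that(1,2,3), of D.R "D.U (f \<omega>)" s] max by simp
    qed
    \<comment> \<open>The entry values of \<open>k\<close> for the two signs differ, so its residual
      is nonzero, and half of its absolute value is a lower bound for the runner-up value.\<close>
    have pos: "0 < D.second j s (f \<omega>)"
    proof -
      have "?ev (k, 1) \<noteq> ?ev (k, - 1)" using inj_onD[OF inj_j, of "(k, 1)" "(k, - 1)"] k by auto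
      then have "D.U (f \<omega>) k - D.R k j * D.U (f \<omega>) j \<noteq> 0" by (auto simp: entry_value_def)
      then show ?thesis
        using abs_residual_le_runner_up[of k p j D.R s "D.U (f \<omega>)", OF k(1,2) D.corr[OF j(1) k(1,2)] j(2)] by linarith
    qed
    interpret first_step n p X "y \<omega>" j k s s'
      using X yc unit corr j k max strict pos win unfolding R U U' by unfold_locales (auto simp del: insert_iff)
    have eq: "cov_test_stat1 X (y \<omega>) \<sigma> = s * D.U (f \<omega>) j * (s * D.U (f \<omega>) j - D.second j s (f \<omega>)) / \<sigma>\<^sup>2"
      unfolding cov_test_stat1_eq R U U' ..
    have "cov_test_stat1 X (y \<omega>) \<sigma> > t \<longleftrightarrow> f \<omega> \<in> D.wins (t * \<sigma>\<^sup>2) (j, s)"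
      using win fP \<open>0 < \<sigma>\<close> unfolding eq D.wins_def by (simp add: pos_less_divide_eq)
    also have "\<dots> \<longleftrightarrow> f \<omega> \<in> ?W"
    proof
      assume "f \<omega> \<in> ?W"
      then obtain j' s' where js: "j' < p" "s' \<in> {1, - 1}" "f \<omega> \<in> D.wins (t * \<sigma>\<^sup>2) (j', s')" by blast
      then have "D.second j' s' (f \<omega>) < s' * D.U (f \<omega>) j'" by (simp add: D.wins_def)
      from D.winner_unique[OF j win js(1,2) this] js(3) show "f \<omega> \<in> D.wins (t * \<sigma>\<^sup>2) (j, s)" by simp
    qed (use j in blast)
    finally show ?thesis .
  qed
  have "AE \<omega> in M. (cov_test_stat1 X (y \<omega>) \<sigma> > t) = (f \<omega> \<in> ?W)"
  proof -
    have AE_f: "AE \<omega> in M. Q (f \<omega>)" if "AE v in normal_product n \<sigma>. Q v" for Q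
      using that unfolding distr(2)[symmetric] by (rule AE_distrD[OF distr(1)])
    from AE_f[OF D.AE_abs_distinct] AE_f[OF D.AE_entry_values_distinct] AE_space show ?thesis
    proof eventually_elim
      case (elim \<omega>)
      show ?case by (rule generic[OF elim(3,1,2)])
    qed
  qed
  moreover have "{\<omega> \<in> space M. f \<omega> \<in> ?W} \<in> sets M"
    using measurable_sets[OF distr(1) Wset] by (simp add: vimage_def Int_def conj_commute)
  ultimately have "measure (completion M) {\<omega> \<in> space M. t < cov_test_stat1 X (y \<omega>) \<sigma>} =
      measure M {\<omega> \<in> space M. f \<omega> \<in> ?W}"
    by (intro measure_completion_AE_eq) auto
  also have "\<dots> = measure (distr M (PiM {..<n} (\<lambda>_. borel)) f) ?W"
    by (subst measure_distr[OF distr(1) Wset]) (auto intro!: arg_cong[where f="measure M"])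
  finally show ?thesis unfolding distr(2) .
qed

text \<open>The product is the exponential of \<open>ln p * (1 + ln c * (d p / ln p))\<close>. Since
  \<open>ln c < 0\<close>, the bracket tends to minus infinity.\<close>

lemma mult_powr_growth_tendsto_0:
  assumes c: "0 < c" "c < 1" and d: "filterlim (\<lambda>p. d p / ln (real p)) at_top sequentially"
  shows "(\<lambda>p. real p * c powr d p) \<longlonglongrightarrow> 0"
proof -
  have "filterlim (\<lambda>p. - ln c * (d p / ln (real p))) at_top sequentially"
    using c by (intro filterlim_tendsto_pos_mult_at_top[OF tendsto_const _ d]) simp
  then have "filterlim (\<lambda>p. - 1 + - ln c * (d p / ln (real p))) at_top sequentially"
    by (rule filterlim_tendsto_add_at_top[OF tendsto_const])
  moreover have "filterlim (\<lambda>p. ln (real p)) at_top sequentially" by real_asymp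
  ultimately have "filterlim (\<lambda>p. (- 1 + - ln c * (d p / ln (real p))) * ln (real p)) at_top sequentially"
    by (rule filterlim_at_top_mult_at_top)
  then have "filterlim (\<lambda>p. - ((- 1 + - ln c * (d p / ln (real p))) * ln (real p))) at_bot sequentially"
    by (simp add: filterlim_uminus_at_top)
  then have "((\<lambda>p. exp (- ((- 1 + - ln c * (d p / ln (real p))) * ln (real p)))) \<longlongrightarrow> 0) sequentially"
    by (rule filterlim_compose[OF exp_at_bot])
  moreover have "eventually (\<lambda>p. exp (- ((- 1 + - ln c * (d p / ln (real p))) * ln (real p))) = real p * c powr d p) sequentially"
    using eventually_ge_at_top[of 2]
  proof eventually_elim
    case (elim p)
    then have "ln (real p) > 0" by simp
    then have "- ((- 1 + - ln c * (d p / ln (real p))) * ln (real p)) = ln (real p) + d p * ln c"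
      by (simp add: field_simps)
    then show ?case using elim c by (simp add: exp_add powr_def)
  qed
  ultimately show ?thesis by (rule Lim_transform_eventually)
qed

theorem theorem2:
  fixes n :: "nat \<Rightarrow> nat"
    and X :: "nat \<Rightarrow> real mat"
    and d :: "nat \<Rightarrow> real"
    and \<delta> \<sigma> :: real
    and M :: "nat \<Rightarrow> 'a measure"
    and y :: "nat \<Rightarrow> 'a \<Rightarrow> real vec"
  assumes "\<And>p. p \<ge> 1 \<Longrightarrow> X p \<in> carrier_mat (n p) p"
    and "\<And>p j. p \<ge> 1 \<Longrightarrow> j < p \<Longrightarrow> l2_norm (col (X p) j) = 1"
    and "\<And>p. p \<ge> 1 \<Longrightarrow> columns_in_general_position (X p)"
    and "\<delta> > 0"
    and "\<And>p j. p \<ge> 1 \<Longrightarrow> j < p \<Longrightarrow>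
           \<exists>S \<subseteq> {..<p} - {j}.
             (\<forall>i\<in>S. invertible_mat (submatrix (transpose_mat (X p) * X p) (S - {i}) (S - {i})) \<and>
                    partial_variance (transpose_mat (X p) * X p) S i \<ge> \<delta>\<^sup>2) \<and>
             real (card S) \<ge> d p"
    and "filterlim (\<lambda>p. d p / ln (real p)) at_top sequentially"
    and "\<sigma> > 0"
    and "\<And>p. p \<ge> 1 \<Longrightarrow> isotropic_gaussian (M p) (n p) \<sigma> (y p)"
  shows "\<forall>t \<ge> 0. (\<lambda>p. measure (completion (M p))
             {\<omega> \<in> space (M p). cov_test_stat1 (X p) (y p \<omega>) \<sigma> > t}) \<longlonglongrightarrow> exp (- t)"
proof (intro allI impI)
  fix t :: real assume t: "0 \<le> t"
  let ?pr = "\<lambda>p. measure (completion (M p)) {\<omega> \<in> space (M p). cov_test_stat1 (X p) (y p \<omega>) \<sigma> > t}"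
  show "?pr \<longlonglongrightarrow> exp (- t)"
  proof (rule LIMSEQ_I)
    fix r :: real assume r: "0 < r"
    obtain m0 where m0: "0 < m0"
      "\<And>m. m0 \<le> m \<Longrightarrow> \<bar>gap_tail \<sigma> (t * \<sigma>\<^sup>2) m - exp (- t) * gap_tail \<sigma> 0 m\<bar> \<le> r / 2 * gap_tail \<sigma> 0 m"
      using gap_tail_ratio[OF \<open>0 < \<sigma>\<close> t, of "r / 2"] r by auto
    define b where "b = 2 * m0 + \<sigma>"
    \<comment> \<open>The maximum with \<open>1/2\<close> keeps the base positive, so that real
      exponents can be used.\<close>
    define c where "c = max (1/2) (1 - upper_tail \<sigma> (b / \<delta>))"
    define c0 where "c0 = measure (normal_measure \<sigma>) {- \<sigma>..\<sigma>}"
    have c: "0 < c" "c < 1" using upper_tail_pos[OF \<open>0 < \<sigma>\<close>, of "b / \<delta>"] by (auto simp: c_def)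
    have c0: "0 < c0" unfolding c0_def using \<open>0 < \<sigma>\<close> by (intro measure_normal_pos) auto
    have b: "0 \<le> b" using m0 \<open>0 < \<sigma>\<close> by (simp add: b_def)
    \<comment> \<open>The factor 2 counts the signs, and \<open>1 / c0\<close> is the price of
      restricting one coordinate to at most \<open>\<sigma>\<close> in absolute value. With
      \<open>p \<ge> 2\<close> a runner-up exists.\<close>
    have bound: "\<bar>?pr p - exp (- t)\<bar> \<le> r / 2 + 2 / c0 * (real p * c powr d p)" if p: "2 \<le> p" for p
    proof -
      have p1: "1 \<le> p" using p by simp
      let ?x = "\<lambda>k i. X p $$ (i, k)"
      note Xc = assms(1)[OF p1]
      have unit: "col (X p) j \<bullet> col (X p) j = 1" if "j < p" for j
        using assms(2)[OF p1 that] l2_norm_square[of "col (X p) j"] by simp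
      have corr: "\<bar>col (X p) k \<bullet> col (X p) j\<bar> < 1" if "j < p" "k < p" "k \<noteq> j" for j k
        using general_position_corr[OF Xc assms(3)[OF p1] unit] that by blast
      interpret D: gaussian_design "n p" p \<sigma> ?x
        using p \<open>0 < \<sigma>\<close> unit corr dot_eq_scalar_prod(2)[OF Xc zero_carrier_vec] by unfold_locales auto
      have pr: "?pr p = D.P.prob (\<Union>(D.wins (t * \<sigma>\<^sup>2) ` D.signed_indices))"
        using prob_cov_test_stat1[OF p Xc \<open>0 < \<sigma>\<close> unit corr assms(8)[OF p1]] by simp
      have small: "D.P.prob {v \<in> space D.P. D.second j s v < m0} \<le> c powr d p / c0"
        if j: "j < p" "s \<in> {1, - 1}" for j s
      proof -
        from assms(5)[OF p1 j(1)] obtain S where S: "S \<subseteq> {..<p} - {j}" "d p \<le> real (card S)"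
          and inv: "\<And>i. i \<in> S \<Longrightarrow> invertible_mat (submatrix (transpose_mat (X p) * X p) (S - {i}) (S - {i}))"
          and pv: "\<And>i. i \<in> S \<Longrightarrow> \<delta>\<^sup>2 \<le> partial_variance (transpose_mat (X p) * X p) S i"
          by blast
        have finS: "finite S" using S finite_subset by blast
        have "D.P.prob {v \<in> space D.P. D.second j s v < m0} * c0
            \<le> D.P.prob {v \<in> space D.P. \<forall>k\<in>S. \<bar>D.U v k\<bar> \<le> b}"
          unfolding c0_def b_def using m0 by (intro D.prob_second_less[OF j S(1)]) simp
        also have "\<dots> \<le> (1 - upper_tail \<sigma> (b / \<delta>)) ^ card S"
        proof (rule small_ball[OF \<open>0 < \<sigma>\<close> \<open>0 < \<delta>\<close> b finS])
          fix i assume i: "i \<in> S"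
          then have "i < p" using S by auto
          show "\<exists>e. dot (n p) e e = 1 \<and> (\<forall>k\<in>S - {i}. dot (n p) (?x k) e = 0) \<and> \<delta> \<le> dot (n p) (?x i) e"
            by (rule partial_variance_direction[OF Xc _ i unit[OF \<open>i < p\<close>] inv[OF i] pv[OF i] \<open>0 < \<delta>\<close>])
               (use S in auto)
        qed
        also have "\<dots> \<le> c ^ card S"
          by (intro power_mono) (auto simp: c_def upper_tail_def)
        also have "\<dots> = c powr real (card S)" using c by (simp add: powr_realpow)
        \<comment> \<open>As \<open>c < 1\<close>, the larger exponent \<open>card S\<close> gives
          the smaller power.\<close>
        also have "\<dots> \<le> c powr d p" using S c by (intro powr_mono') auto
        finally show ?thesis using c0 by (simp add: pos_le_divide_eq)
      qed
      have "\<bar>?pr p - exp (- t)\<bar> \<le> r / 2 + (\<Sum>(j, s)\<in>D.signed_indices. D.P.prob {v \<in> space D.P. D.second j s v < m0})"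
        unfolding pr using r by (intro D.prob_wins_approx t m0(2)) auto
      also have "\<dots> \<le> r / 2 + (\<Sum>a\<in>D.signed_indices. c powr d p / c0)"
        using small by (intro add_left_mono sum_mono) auto
      also have "\<dots> = r / 2 + 2 / c0 * (real p * c powr d p)"
        by (simp add: card_cartesian_product)
      finally show ?thesis .
    qed
    have "(\<lambda>p. r / 2 + 2 / c0 * (real p * c powr d p)) \<longlonglongrightarrow> r / 2 + 2 / c0 * 0"
      by (intro tendsto_intros mult_powr_growth_tendsto_0 c assms(6))
    from order_tendstoD(2)[OF this, of r] r
    have "eventually (\<lambda>p. r / 2 + 2 / c0 * (real p * c powr d p) < r) sequentially" by simp
    with eventually_ge_at_top[of 2] have "eventually (\<lambda>p. norm (?pr p - exp (- t)) < r) sequentially"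
    proof eventually_elim
      case (elim p)
      then show ?case using bound[of p] by simp
    qed
    then show "\<exists>no. \<forall>p\<ge>no. norm (?pr p - exp (- t)) < r" by (simp add: eventually_sequentially)
  qed
qed

end
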